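(* Let $\mathcal{L}$ be a set of lines of the elliptic plane such that its polar set $p(\mathcal{L})=\{p(L) : L\in\mathcal{L}\}$ is a bounded, compact and full-dimensional subset of the elliptic plane. Among all conics with two given axes $X,Y$ that contain $\mathcal{L}$ there exists exactly one of minimal measure.
   Context: The elliptic plane is the unit sphere $S^2\subset\mathbb{R}^3$ with antipodal points identified; its lines are the images of great circles (intersections of $S^2$ with two-dimensional linear subspaces), and area is inherited from $S^2$. The absolute pole $p(L)$ of a line $L$ is the point of the elliptic plane spanned by the normal vector of the plane defining $L$. The measure of a set $\mathcal{K}$ of lines is $m(\mathcal{K})=\operatorname{area}\{p(L) : L\in\mathcal{K}\}$. A conic is a set $C=\{x\in S^2 : x^{T}Mx=0\}$ where $M\in\mathbb{R}^{3\times 3}$ is symmetric, invertible and indefinite, scaled so that it has eigenvalues $\nu_1\ge\nu_2>0$ and $\nu_3=-1$. The center of $C$ is the point $c$ spanned by an eigenvector for the eigenvalue $-1$; the axes of $C$ are the two lines joining $c$ with the points spanned by two orthogonal eigenvectors for $\nu_1$ and $\nu_2$ (if $\nu_1=\nu_2$, the conic is a circle and any two orthogonal lines through $c$ may serve as axes). Thus two given axes $X,Y$ are two lines meeting orthogonally in the common center. A conic $C$ is said to contain a set $\mathcal{L}$ of lines if every $L\in\mathcal{L}$ has at most one real intersection point with $C$ (counted in the elliptic plane). The measure of a conic $C$ is the measure $m$ of the set of all lines that have at most one real intersection point with $C$. A set of points is called bounded if it is contained in a circle (a conic with $\nu_1=\nu_2$) in the sense that $x^TMx\le 0$ for all its points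 $x$, where $M$ is the matrix of the circle, and full-dimensional if it is not contained in a line.
   Formalization: It is additionally assumed that no line of L passes through the common center of X and Y: a line through the center meets every conic with these axes in two points, so otherwise no such conic contains L and the claim is false. *)

theory Defs
  imports "HOL-Analysis.Analysis"
begin

text \<open>
  A point of the elliptic plane is an antipodal pair of unit vectors; \<^term>\<open>sgn v\<close>
  is \<^term>\<open>v /\<^sub>R norm v\<close>, so the following is the point spanned by \<^term>\<open>v \<noteq> 0\<close>.
\<close>

definition ell_point :: "real^3 \<Rightarrow> (real^3) set" where
  "ell_point v = {sgn v, - sgn v}"

definition elliptic_plane :: "(real^3) set set" where
  "elliptic_plane = ell_point ` sphere 0 1"

definition elliptic_topology :: "(real^3) set topology" where
  "elliptic_topology = topology (\<lambda>U. U \<subseteq> elliptic_plane \<and>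
     openin (top_of_set (sphere 0 1)) {x \<in> sphere 0 1. ell_point x \<in> U})"

lemma openin_elliptic_topology:
  "openin elliptic_topology U \<longleftrightarrow> U \<subseteq> elliptic_plane \<and>
     openin (top_of_set (sphere 0 1)) {x \<in> sphere 0 1. ell_point x \<in> U}"
proof -
  let ?V = "\<lambda>U. {x \<in> sphere (0::real^3) 1. ell_point x \<in> U}"
  have "istopology (\<lambda>U. U \<subseteq> elliptic_plane \<and> openin (top_of_set (sphere 0 1)) (?V U))"
    unfolding istopology_def
  proof (rule conjI; intro allI impI)
    fix S T
    assume S: "S \<subseteq> elliptic_plane \<and> openin (top_of_set (sphere 0 1)) (?V S)"
      and T: "T \<subseteq> elliptic_plane \<and> openin (top_of_set (sphere 0 1)) (?V T)"
    have "?V (S \<inter> T) = ?V S \<inter> ?V T" by blast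
    moreover have "openin (top_of_set (sphere 0 1)) (?V S \<inter> ?V T)"
      using S T by (intro openin_Int) blast+
    ultimately show "S \<inter> T \<subseteq> elliptic_plane \<and> openin (top_of_set (sphere 0 1)) (?V (S \<inter> T))"
      using S by (simp only:) blast
  next
    fix \<K> :: "(real^3) set set set"
    assume K: "\<forall>K\<in>\<K>. K \<subseteq> elliptic_plane \<and> openin (top_of_set (sphere 0 1)) (?V K)"
    have "?V (\<Union>\<K>) = \<Union>(?V ` \<K>)" by blast
    moreover have "openin (top_of_set (sphere 0 1)) (\<Union>(?V ` \<K>))"
      using K by (intro openin_Union) blast
    moreover have "\<Union>\<K> \<subseteq> elliptic_plane" using K by blast
    ultimately show "\<Union>\<K> \<subseteq> elliptic_plane \<and> openin (top_of_set (sphere 0 1)) (?V (\<Union>\<K>))"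
      by (simp only:)
  qed
  then show ?thesis
    unfolding elliptic_topology_def by (simp only: topology_inverse')
qed

lemma topspace_elliptic_topology: "topspace elliptic_topology = elliptic_plane"
proof -
  have "{x \<in> sphere 0 1. ell_point x \<in> elliptic_plane} = sphere 0 1"
    by (auto simp: elliptic_plane_def)
  then have "openin elliptic_topology elliptic_plane"
    unfolding openin_elliptic_topology by simp
  moreover have "topspace elliptic_topology \<subseteq> elliptic_plane"
    using openin_topspace[of elliptic_topology] unfolding openin_elliptic_topology by blast
  ultimately show ?thesis
    by (simp add: openin_subset subset_antisym)
qed

lemma quotient_map_ell_point:
  "quotient_map (top_of_set (sphere 0 1)) elliptic_topology ell_point"
  unfolding quotient_map_def topspace_elliptic_topology openin_elliptic_topology
  by (auto simp: elliptic_plane_def)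

definition line_of_plane :: "(real^3) set \<Rightarrow> (real^3) set set" where
  "line_of_plane S = ell_point ` (S \<inter> sphere 0 1)"

definition elliptic_lines :: "(real^3) set set set" where
  "elliptic_lines = line_of_plane ` {S. subspace S \<and> dim S = 2}"

definition abs_pole :: "(real^3) set set \<Rightarrow> (real^3) set" where
  "abs_pole K = (THE P. \<exists>S n. subspace S \<and> dim S = 2 \<and> K = line_of_plane S \<and>
     n \<noteq> 0 \<and> (\<forall>x\<in>S. n \<bullet> x = 0) \<and> P = ell_point n)"

definition orthogonal_lines :: "(real^3) set set \<Rightarrow> (real^3) set set \<Rightarrow> bool" where
  "orthogonal_lines X Y \<longleftrightarrow> X \<in> elliptic_lines \<and> Y \<in> elliptic_lines \<and>
     (\<forall>m\<in>abs_pole X. \<forall>n\<in>abs_pole Y. orthogonal m n)"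

text \<open>
  The area of a subset of the unit sphere is three times the volume of the solid cone over it
  with apex at the origin. The union of a set of elliptic points is its preimage on the sphere,
  which covers it twice.
\<close>

definition sphere_area :: "(real^3) set \<Rightarrow> real" where
  "sphere_area A = 3 * measure lebesgue {t *\<^sub>R x | t x. 0 \<le> t \<and> t \<le> 1 \<and> x \<in> A}"

definition elliptic_area :: "(real^3) set set \<Rightarrow> real" where
  "elliptic_area P = sphere_area (\<Union>P) / 2"

definition line_measure :: "(real^3) set set set \<Rightarrow> real" where
  "line_measure \<K> = elliptic_area (abs_pole ` \<K>)"

text \<open>
  The characteristic polynomial records the eigenvalues \<^term>\<open>\<nu>\<^sub>1\<close>, \<^term>\<open>\<nu>\<^sub>2\<close>, \<^term>\<open>-1::real\<close>
  with multiplicity.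
\<close>

definition conic_eigenvalues :: "real^3^3 \<Rightarrow> real \<Rightarrow> real \<Rightarrow> bool" where
  "conic_eigenvalues M \<nu>\<^sub>1 \<nu>\<^sub>2 \<longleftrightarrow> \<nu>\<^sub>1 \<ge> \<nu>\<^sub>2 \<and> \<nu>\<^sub>2 > 0 \<and>
     (\<forall>t. det (mat t - M) = (t - \<nu>\<^sub>1) * (t - \<nu>\<^sub>2) * (t + 1))"

definition conic_matrix :: "real^3^3 \<Rightarrow> bool" where
  "conic_matrix M \<longleftrightarrow> transpose M = M \<and> invertible M \<and>
     (\<exists>x. x \<bullet> (M *v x) > 0) \<and> (\<exists>x. x \<bullet> (M *v x) < 0) \<and>
     (\<exists>\<nu>\<^sub>1 \<nu>\<^sub>2. conic_eigenvalues M \<nu>\<^sub>1 \<nu>\<^sub>2)"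

definition conic :: "real^3^3 \<Rightarrow> (real^3) set" where
  "conic M = {x \<in> sphere 0 1. x \<bullet> (M *v x) = 0}"

definition circle_matrix :: "real^3^3 \<Rightarrow> bool" where
  "circle_matrix M \<longleftrightarrow> conic_matrix M \<and> (\<exists>\<nu>. conic_eigenvalues M \<nu> \<nu>)"

text \<open>
  The pair of axes is unordered: either of them may belong to the larger eigenvalue. In the case
  of a circle every pair of orthogonal lines through the center qualifies.
\<close>

definition has_axes :: "(real^3) set \<Rightarrow> (real^3) set set \<Rightarrow> (real^3) set set \<Rightarrow> bool" where
  "has_axes C X Y \<longleftrightarrow> (\<exists>M \<nu>\<^sub>1 \<nu>\<^sub>2 c u\<^sub>1 u\<^sub>2.
     conic_matrix M \<and> C = conic M \<and> conic_eigenvalues M \<nu>\<^sub>1 \<nu>\<^sub>2 \<and>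
     c \<noteq> 0 \<and> M *v c = - c \<and>
     u\<^sub>1 \<noteq> 0 \<and> M *v u\<^sub>1 = \<nu>\<^sub>1 *\<^sub>R u\<^sub>1 \<and>
     u\<^sub>2 \<noteq> 0 \<and> M *v u\<^sub>2 = \<nu>\<^sub>2 *\<^sub>R u\<^sub>2 \<and> orthogonal u\<^sub>1 u\<^sub>2 \<and>
     {X, Y} = {line_of_plane (span {c, u\<^sub>1}), line_of_plane (span {c, u\<^sub>2})})"

definition meets_at_most_once :: "(real^3) set set \<Rightarrow> (real^3) set \<Rightarrow> bool" where
  "meets_at_most_once K C \<longleftrightarrow>
     (\<forall>P \<in> K \<inter> ell_point ` C. \<forall>Q \<in> K \<inter> ell_point ` C. P = Q)"

definition contains_lines :: "(real^3) set \<Rightarrow> (real^3) set set set \<Rightarrow> bool" where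
  "contains_lines C \<L> \<longleftrightarrow> (\<forall>K\<in>\<L>. meets_at_most_once K C)"

definition conic_measure :: "(real^3) set \<Rightarrow> real" where
  "conic_measure C = line_measure {K \<in> elliptic_lines. meets_at_most_once K C}"

definition elliptic_bounded :: "(real^3) set set \<Rightarrow> bool" where
  "elliptic_bounded P \<longleftrightarrow> (\<exists>M. circle_matrix M \<and> (\<forall>p\<in>P. \<forall>x\<in>p. x \<bullet> (M *v x) \<le> 0))"

definition full_dimensional :: "(real^3) set set \<Rightarrow> bool" where
  "full_dimensional P \<longleftrightarrow> \<not> (\<exists>K\<in>elliptic_lines. P \<subseteq> K)"

lemma ell_point_eq_imp_scale:
  assumes "ell_point x = ell_point y" "x \<noteq> 0" "y \<noteq> 0"
  shows "\<exists>k. k \<noteq> 0 \<and> x = k *\<^sub>R y"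
proof -
  have "sgn x = sgn y \<or> sgn x = - sgn y"
    using assms(1) by (auto simp: ell_point_def doubleton_eq_iff)
  then have "x = (norm x / norm y) *\<^sub>R y \<or> x = (- norm x / norm y) *\<^sub>R y"
  proof
    assume "sgn x = sgn y"
    then have "norm x *\<^sub>R sgn x = norm x *\<^sub>R sgn y" by simp
    then show ?thesis using assms by (simp add: sgn_div_norm divide_inverse)
  next
    assume "sgn x = - sgn y"
    then have "norm x *\<^sub>R sgn x = norm x *\<^sub>R (- sgn y)" by simp
    then show ?thesis using assms by (simp add: sgn_div_norm divide_inverse)
  qed
  moreover have "norm x / norm y \<noteq> 0" "- norm x / norm y \<noteq> 0" using assms by auto
  ultimately show ?thesis by blast
qed

lemma ell_point_scaleR: "k \<noteq> 0 \<Longrightarrow> ell_point (k *\<^sub>R x) = ell_point x"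
  by (cases "k > 0") (auto simp: ell_point_def sgn_scaleR)

lemma line_of_plane_subset:
  assumes "line_of_plane S = line_of_plane T" "subspace S" "subspace T"
  shows "S \<subseteq> T"
proof
  fix x assume x: "x \<in> S"
  show "x \<in> T"
  proof (cases "x = 0")
    case False
    then have "sgn x \<in> S \<inter> sphere 0 1"
      using x assms(2) by (auto simp: sgn_div_norm subspace_scale)
    then have "ell_point (sgn x) \<in> line_of_plane T"
      by (subst assms(1)[symmetric], unfold line_of_plane_def) (rule imageI)
    then obtain y where y: "y \<in> T" "norm y = 1" "ell_point (sgn x) = ell_point y"
      by (auto simp: line_of_plane_def)
    moreover have "ell_point (sgn x) = ell_point x"
      using False by (simp add: sgn_div_norm ell_point_scaleR)
    moreover have "y \<noteq> 0" using y by auto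
    ultimately obtain k where "x = k *\<^sub>R y" using ell_point_eq_imp_scale False by metis
    then show ?thesis using y assms(3) by (simp add: subspace_scale)
  qed (use assms in \<open>simp add: subspace_0\<close>)
qed

lemma line_of_plane_inject:
  "subspace S \<Longrightarrow> subspace T \<Longrightarrow> line_of_plane S = line_of_plane T \<longleftrightarrow> S = T"
  using line_of_plane_subset by (metis subset_antisym)

lemma abs_pole_line_of_plane:
  assumes "subspace S" "dim S = 2" "n \<noteq> 0" "\<forall>x\<in>S. n \<bullet> x = 0"
  shows "abs_pole (line_of_plane S) = ell_point n"
  unfolding abs_pole_def
proof (rule the_equality)
  fix P
  assume "\<exists>T m. subspace T \<and> dim T = 2 \<and> line_of_plane S = line_of_plane T \<and>
     m \<noteq> 0 \<and> (\<forall>x\<in>T. m \<bullet> x = 0) \<and> P = ell_point m"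
  then obtain m where m: "m \<noteq> 0" "\<forall>x\<in>S. m \<bullet> x = 0" "P = ell_point m"
    using assms(1) line_of_plane_inject by metis
  let ?N = "{y. \<forall>x\<in>S. orthogonal x y}"
  have sub: "subspace ?N"
    by (rule subspace_orthogonal_to_vectors)
  have "dim {y \<in> UNIV. \<forall>x\<in>S. orthogonal x y} + dim S = dim (UNIV :: (real^3) set)"
    using assms(1) by (intro dim_subspace_orthogonal_to_vectors) auto
  then have "dim ?N = 1" using assms(2) by simp
  moreover have nN: "n \<in> ?N" "m \<in> ?N"
    using assms(4) m(2) by (auto simp: orthogonal_def inner_commute)
  moreover have "dim (span {n}) = 1" using assms(3) by simp
  ultimately have "span {n} = ?N"
    using sub by (intro subspace_dim_equal) (auto simp: span_minimal dest: span_minimal[of "{n}" ?N, THEN subsetD])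
  then have "m \<in> span {n}" using nN by simp
  then obtain k where "m = k *\<^sub>R n" by (auto simp: span_singleton)
  then show "P = ell_point n" using m by (auto simp: ell_point_scaleR)
qed (use assms in blast)

lemma elliptic_area_elliptic_plane: "elliptic_area elliptic_plane = 2 * pi"
proof -
  have "\<Union>elliptic_plane = sphere 0 1"
    by (auto simp: elliptic_plane_def ell_point_def sgn_div_norm)
  moreover have "{t *\<^sub>R x | t x. 0 \<le> t \<and> t \<le> 1 \<and> x \<in> sphere (0::real^3) 1} = cball 0 1"
  proof safe
    fix x :: "real^3" assume x: "x \<in> cball 0 1"
    show "\<exists>t y. x = t *\<^sub>R y \<and> 0 \<le> t \<and> t \<le> 1 \<and> y \<in> sphere 0 1"
    proof (cases "x = 0")
      case True
      then show ?thesis by (intro exI[of _ 0] exI[of _ "axis 1 1"]) auto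
    next
      case False
      then show ?thesis using x
        by (intro exI[of _ "norm x"] exI[of _ "sgn x"]) (auto simp: sgn_div_norm)
    qed
  qed auto
  moreover have "measure lebesgue (cball (0::real^3) 1) = 4 / 3 * pi"
    by (simp add: content_cball unit_ball_vol_3)
  ultimately show ?thesis
    by (simp add: elliptic_area_def sphere_area_def)
qed

end

theory Submission
  imports Defs
begin

text \<open>
  Why the theorem is true. Let \<open>e3\<close> be a unit vector spanning the common center, and let the axes
  \<open>X\<close> and \<open>Y\<close> lie in the planes orthogonal to the unit vectors \<open>e2\<close> and \<open>e1\<close>. Eigenvectors of a
  symmetric matrix for different eigenvalues are orthogonal, so the conics with axes \<open>X\<close> and \<open>Y\<close>
  are exactly the curves \<open>a x1\<^sup>2 + b x2\<^sup>2 = x3\<^sup>2\<close> with positive \<open>a\<close> and \<open>b\<close> (\<open>has_axes_iff\<close>). A line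
  with normal vector \<open>n\<close> has at most one point on this conic if and only if \<open>n\<close> satisfies the dual
  inequality \<open>s n1\<^sup>2 + t n2\<^sup>2 \<le> n3\<^sup>2\<close>, where \<open>s = 1/a\<close> and \<open>t = 1/b\<close>
  (\<open>meets_at_most_once_frame_conic\<close>). In the parameters \<open>(s, t)\<close> the conics that contain the given
  lines therefore form a convex set, cut out by one linear inequality for every pole.

  The measure of a conic is the area of its dual region on the sphere, hence a multiple of the volume
  of the solid cone \<open>s x\<^sup>2 + t y\<^sup>2 \<le> z\<^sup>2\<close> in the unit ball. The complement of this cone in the ball is
  a wedge. Over a point \<open>(x, y)\<close> of the unit disc the wedge has height twice the minimum of
  \<open>sqrt (s x\<^sup>2 + t y\<^sup>2)\<close> and \<open>sqrt (1 - x\<^sup>2 - y\<^sup>2)\<close>. For a fixed point \<open>(x, y)\<close> the first term is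
  concave in \<open>(s, t)\<close> and the second is constant, so the volume of the wedge is concave, and it is
  strictly concave because the first term is the smaller one near the origin
  (\<open>wedge_integral_midpoint_strict\<close>). Minimal measure means maximal wedge, and a strictly concave
  function on a convex set has at most one maximum.

  For existence, the closed set of all feasible \<open>(s, t)\<close> with nonnegative entries is bounded, because
  the poles are not all orthogonal to \<open>e1\<close> and not all orthogonal to \<open>e2\<close>; it contains a pair of
  positive numbers, because the poles form a compact set on which \<open>n3\<close> does not vanish. So the volume
  of the wedge attains a maximum, but a maximum with \<open>s = 0\<close> or \<open>t = 0\<close> would not come from a conic.
  It is excluded because the slope is infinite there (\<open>wedge_integral_leaves_boundary\<close>): raising
  \<open>s\<close> from \<open>0\<close> to \<open>u\<close> gains \<open>sqrt (u x\<^sup>2 + t y\<^sup>2) - sqrt t \<bar>y\<bar>\<close>, which for \<open>x\<close> away from \<open>0\<close> is at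
  least of the order of \<open>u / (sqrt u + \<bar>y\<bar>)\<close>. Integrating over \<open>y\<close> gives at least the order of
  \<open>u ln (1 / u)\<close>, whereas the change of \<open>t\<close> along a segment of feasible parameters costs only a
  multiple of \<open>u\<close>.
\<close>

section \<open>Concavity of the wedge volume\<close>

text \<open>
  Half the height of the wedge over the point \<open>p\<close>, for the parameters \<open>k = (s, t)\<close>. The maximum with
  \<open>0\<close> makes the height vanish outside the unit disc, so that it can be integrated over a square.
\<close>

definition wedge_height :: "real \<times> real \<Rightarrow> real \<times> real \<Rightarrow> real" where
  "wedge_height k p = min (sqrt (fst k * (fst p)\<^sup>2 + snd k * (snd p)\<^sup>2))
     (sqrt (max 0 (1 - (fst p)\<^sup>2 - (snd p)\<^sup>2)))"

definition wedge_integral :: "real \<times> real \<Rightarrow> real" where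
  "wedge_integral k = integral (cbox (-1, -1) (1, 1)) (wedge_height k)"

lemma sqrt_concave:
  fixes A B u :: real
  assumes "0 \<le> A" "0 \<le> B" "0 \<le> u" "u \<le> 1"
  shows "(1 - u) * sqrt A + u * sqrt B \<le> sqrt ((1 - u) * A + u * B)"
proof (rule real_le_rsqrt)
  obtain \<alpha> \<beta> where ab: "\<alpha> = sqrt A" "\<beta> = sqrt B" by blast
  have "0 \<le> u * (1 - u) * (\<alpha> - \<beta>)\<^sup>2" using assms by simp
  then have "((1 - u) * \<alpha> + u * \<beta>)\<^sup>2 \<le> (1 - u) * \<alpha>\<^sup>2 + u * \<beta>\<^sup>2"
    by (simp add: power2_eq_square algebra_simps)
  then show "((1 - u) * sqrt A + u * sqrt B)\<^sup>2 \<le> (1 - u) * A + u * B"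
    using assms by (simp add: ab)
qed

lemma sqrt_midpoint_strict:
  fixes A B :: real
  assumes "0 \<le> A" "0 \<le> B" "A \<noteq> B"
  shows "(sqrt A + sqrt B) / 2 < sqrt ((A + B) / 2)"
proof (rule real_less_rsqrt)
  obtain \<alpha> \<beta> where ab: "\<alpha> = sqrt A" "\<beta> = sqrt B" by blast
  then have AB: "A = \<alpha>\<^sup>2" "B = \<beta>\<^sup>2" using assms by auto
  then have "0 < (\<alpha> - \<beta>)\<^sup>2" using assms by auto
  then have "((\<alpha> + \<beta>) / 2)\<^sup>2 < (\<alpha>\<^sup>2 + \<beta>\<^sup>2) / 2"
    by (simp add: power2_eq_square field_simps)
  then show "((sqrt A + sqrt B) / 2)\<^sup>2 < (A + B) / 2"
    using assms by (simp add: ab)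
qed

lemma wedge_height_concave:
  assumes "0 \<le> fst k" "0 \<le> snd k" "0 \<le> fst l" "0 \<le> snd l" "0 \<le> u" "u \<le> 1"
  shows "(1 - u) * wedge_height k p + u * wedge_height l p
    \<le> wedge_height ((1 - u) *\<^sub>R k + u *\<^sub>R l) p"
proof -
  define q where "q m = fst m * (fst p)\<^sup>2 + snd m * (snd p)\<^sup>2" for m :: "real \<times> real"
  define R where "R = sqrt (max 0 (1 - (fst p)\<^sup>2 - (snd p)\<^sup>2))"
  have "(1 - u) * min (sqrt (q k)) R + u * min (sqrt (q l)) R \<le> (1 - u) * R + u * R"
    using assms by (intro add_mono mult_left_mono) auto
  also have "\<dots> = R" by (simp add: algebra_simps)
  finally have R: "(1 - u) * min (sqrt (q k)) R + u * min (sqrt (q l)) R \<le> R" .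
  have "(1 - u) * min (sqrt (q k)) R + u * min (sqrt (q l)) R \<le> (1 - u) * sqrt (q k) + u * sqrt (q l)"
    using assms by (intro add_mono mult_left_mono) auto
  also have "\<dots> \<le> sqrt ((1 - u) * q k + u * q l)"
    using assms by (intro sqrt_concave) (auto simp: q_def)
  also have "(1 - u) * q k + u * q l = q ((1 - u) *\<^sub>R k + u *\<^sub>R l)"
    by (simp add: q_def algebra_simps)
  finally show ?thesis using R by (simp add: wedge_height_def q_def R_def)
qed

lemma continuous_on_wedge_height [continuous_intros]:
  assumes "continuous_on S f" "continuous_on S g"
  shows "continuous_on S (\<lambda>x. wedge_height (f x) (g x))"
  unfolding wedge_height_def
  by (intro continuous_intros continuous_on_fst continuous_on_snd assms)

lemma wedge_height_integrable: "wedge_height k integrable_on cbox a b"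
  by (intro integrable_continuous continuous_intros)

lemma wedge_height_nonneg: "0 \<le> fst k \<Longrightarrow> 0 \<le> snd k \<Longrightarrow> 0 \<le> wedge_height k p"
  by (simp add: wedge_height_def)

lemma wedge_height_le_1: "wedge_height k p \<le> 1"
  by (simp add: wedge_height_def min_le_iff_disj)

text \<open>
  Near the origin the cone, not the sphere, bounds the wedge. Strict concavity and the infinite slope
  come from this region, where the height varies with the parameters.
\<close>

lemma wedge_height_near_origin:
  assumes "fst k * (fst p)\<^sup>2 + snd k * (snd p)\<^sup>2 \<le> 1 - (fst p)\<^sup>2 - (snd p)\<^sup>2"
  shows "wedge_height k p = sqrt (fst k * (fst p)\<^sup>2 + snd k * (snd p)\<^sup>2)"
proof -
  have "fst k * (fst p)\<^sup>2 + snd k * (snd p)\<^sup>2 \<le> max 0 (1 - (fst p)\<^sup>2 - (snd p)\<^sup>2)"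
    using assms by simp
  then show ?thesis unfolding wedge_height_def by (simp only: min.absorb1 real_sqrt_le_iff)
qed

lemma continuous_on_wedge_integral: "continuous_on S wedge_integral"
proof -
  have "continuous_on S (\<lambda>k. integral (cbox (-1, -1) (1, 1)) (wedge_height k))"
    by (rule integral_continuous_on_param)
       (auto simp: case_prod_unfold intro!: continuous_intros)
  then show ?thesis by (simp add: wedge_integral_def[abs_def])
qed

lemma wedge_integral_swap: "wedge_integral (prod.swap k) = wedge_integral k"
proof -
  have "wedge_integral k =
      integral (cbox (-1) 1) (\<lambda>x. integral (cbox (-1) 1) (\<lambda>y. wedge_height k (x, y)))"
    unfolding wedge_integral_def by (intro integral_prod_continuous continuous_intros)
  also have "\<dots> = integral (cbox (-1) 1) (\<lambda>y. integral (cbox (-1) 1) (\<lambda>x. wedge_height k (x, y)))"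
    by (intro integral_swap_continuous) (auto simp: case_prod_unfold intro!: continuous_intros)
  also have "\<dots> = integral (cbox (-1) 1) (\<lambda>y. integral (cbox (-1) 1) (\<lambda>x. wedge_height (prod.swap k) (y, x)))"
    by (simp add: wedge_height_def algebra_simps)
  also have "\<dots> = wedge_integral (prod.swap k)"
    unfolding wedge_integral_def by (intro integral_prod_continuous[symmetric] continuous_intros)
  finally show ?thesis by simp
qed

text \<open>
  It suffices to look at the two coordinate axes: on the first axis the height depends only on \<open>s\<close>, on
  the second only on \<open>t\<close>, and the square root is strictly concave.
\<close>

lemma wedge_height_midpoint_strict:
  assumes "0 \<le> fst k" "0 \<le> snd k" "0 \<le> fst l" "0 \<le> snd l" "k \<noteq> l"
  obtains p where "p \<in> cbox (-1, -1) (1, 1)"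
    "(wedge_height k p + wedge_height l p) / 2 < wedge_height ((1/2) *\<^sub>R k + (1/2) *\<^sub>R l) p"
proof -
  define \<sigma> where "\<sigma> = 1 + fst k + fst l + snd k + snd l"
  \<comment> \<open>close enough to the origin for \<open>wedge_height_near_origin\<close> with any of the three parameters\<close>
  define d where "d = 1 / sqrt \<sigma>"
  have \<sigma>: "1 \<le> \<sigma>" using assms by (simp add: \<sigma>_def)
  then have d: "0 < d" "d \<le> 1" and d2: "d\<^sup>2 = 1 / \<sigma>" by (auto simp: d_def power_divide)
  have small: "c * d\<^sup>2 \<le> 1 - d\<^sup>2" if "c \<le> fst k + fst l + snd k + snd l" for c
  proof -
    have "(c + 1) * d\<^sup>2 \<le> \<sigma> * d\<^sup>2" using that by (intro mult_right_mono) (auto simp: \<sigma>_def)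
    also have "\<dots> = 1" using \<sigma> by (simp add: d2)
    finally show ?thesis by (simp add: algebra_simps)
  qed
  consider "fst k \<noteq> fst l" | "snd k \<noteq> snd l" using assms(5) by (metis prod_eqI)
  then show ?thesis
  proof cases
    case 1
    have h: "wedge_height m (d, 0) = sqrt (fst m * d\<^sup>2)"
      if "fst m \<le> fst k + fst l + snd k + snd l" for m
      using wedge_height_near_origin[of m "(d, 0)"] small[OF that] by simp
    have eq: "fst ((1/2) *\<^sub>R k + (1/2) *\<^sub>R l) * d\<^sup>2 = (fst k * d\<^sup>2 + fst l * d\<^sup>2) / 2"
      by (simp add: algebra_simps)
    have "(sqrt (fst k * d\<^sup>2) + sqrt (fst l * d\<^sup>2)) / 2
        < sqrt ((fst k * d\<^sup>2 + fst l * d\<^sup>2) / 2)"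
      using assms 1 d by (intro sqrt_midpoint_strict) auto
    moreover have "wedge_height ((1/2) *\<^sub>R k + (1/2) *\<^sub>R l) (d, 0) = sqrt ((fst k * d\<^sup>2 + fst l * d\<^sup>2) / 2)"
      unfolding eq[symmetric] using assms by (intro h) simp
    ultimately have "(wedge_height k (d, 0) + wedge_height l (d, 0)) / 2
        < wedge_height ((1/2) *\<^sub>R k + (1/2) *\<^sub>R l) (d, 0)"
      using assms by (simp only: h)
    then show ?thesis using d by (intro that[of "(d, 0)"]) auto
  next
    case 2
    have h: "wedge_height m (0, d) = sqrt (snd m * d\<^sup>2)"
      if "snd m \<le> fst k + fst l + snd k + snd l" for m
      using wedge_height_near_origin[of m "(0, d)"] small[OF that] by simp
    have eq: "snd ((1/2) *\<^sub>R k + (1/2) *\<^sub>R l) * d\<^sup>2 = (snd k * d\<^sup>2 + snd l * d\<^sup>2) / 2"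
      by (simp add: algebra_simps)
    have "(sqrt (snd k * d\<^sup>2) + sqrt (snd l * d\<^sup>2)) / 2
        < sqrt ((snd k * d\<^sup>2 + snd l * d\<^sup>2) / 2)"
      using assms 2 d by (intro sqrt_midpoint_strict) auto
    moreover have "wedge_height ((1/2) *\<^sub>R k + (1/2) *\<^sub>R l) (0, d) = sqrt ((snd k * d\<^sup>2 + snd l * d\<^sup>2) / 2)"
      unfolding eq[symmetric] using assms by (intro h) simp
    ultimately have "(wedge_height k (0, d) + wedge_height l (0, d)) / 2
        < wedge_height ((1/2) *\<^sub>R k + (1/2) *\<^sub>R l) (0, d)"
      using assms by (simp only: h)
    then show ?thesis using d by (intro that[of "(0, d)"]) auto
  qed
qed

text \<open>
  The concavity defect is a nonnegative continuous function, so its integral over the square vanishes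
  only if it vanishes everywhere.
\<close>

lemma wedge_integral_midpoint_strict:
  assumes k: "0 \<le> fst k" "0 \<le> snd k" and l: "0 \<le> fst l" "0 \<le> snd l" and "k \<noteq> l"
  shows "(wedge_integral k + wedge_integral l) / 2 < wedge_integral ((1/2) *\<^sub>R k + (1/2) *\<^sub>R l)"
proof -
  let ?m = "(1/2) *\<^sub>R k + (1/2) *\<^sub>R l" and ?Q = "cbox (-1, -1) (1, 1) :: (real \<times> real) set"
  define f where "f p = wedge_height ?m p - (wedge_height k p + wedge_height l p) / 2" for p
  have f0: "0 \<le> f p" for p
    using wedge_height_concave[OF k l, of "1/2" p] by (simp add: f_def field_simps)
  have cont: "continuous_on ?Q f" unfolding f_def by (intro continuous_intros) auto
  have int: "integral ?Q f = wedge_integral ?m - (wedge_integral k + wedge_integral l) / 2"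
    unfolding f_def wedge_integral_def
    by (simp add: integral_diff integral_add wedge_height_integrable integrable_add
        integrable_divide)
  have "integral ?Q f \<noteq> 0"
  proof
    assume "integral ?Q f = 0"
    then have "(f has_integral 0) ?Q"
      using cont by (metis integrable_continuous integrable_integral)
    then have z: "f p = 0" if "p \<in> ?Q" for p
      using that f0 cont by (intro has_integral_0_cbox_imp_0[of "(-1,-1)" "(1,1)" f])
        (auto simp: box_ne_empty Basis_prod_def)
    obtain p where "p \<in> ?Q" "f p > 0"
      using wedge_height_midpoint_strict[OF assms] unfolding f_def by (metis diff_gt_0_iff_gt)
    then show False using z[of p] by simp
  qed
  moreover have "0 \<le> integral ?Q f" using f0 by (intro integral_nonneg integrable_continuous cont)
  ultimately show ?thesis using int by linarith
qed

section \<open>The infinite slope at the boundary\<close>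

lemma integral_inverse_affine:
  fixes a b d :: real
  assumes "0 < a" "0 < b" "0 \<le> d"
  shows "integral {0..d} (\<lambda>y. 1 / (a + b * y)) = ln (1 + b * d / a) / b"
proof -
  have pos: "0 < a + b * y" if "0 \<le> y" for y using assms that by (simp add: add_pos_nonneg)
  have "((\<lambda>y. 1 / (a + b * y)) has_integral (ln (a + b * d) / b - ln (a + b * 0) / b)) {0..d}"
    using assms pos
    by (intro fundamental_theorem_of_calculus)
       (auto intro!: derivative_eq_intros simp flip: has_real_derivative_iff_has_vector_derivative)
  moreover have "ln (a + b * d) / b - ln (a + b * 0) / b = ln (1 + b * d / a) / b"
  proof -
    have "1 + b * d / a = (a + b * d) / a" using assms by (simp add: field_simps)
    then have "ln (1 + b * d / a) = ln (a + b * d) - ln a" using assms pos[of d] by (simp add: ln_div)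
    then show ?thesis by (simp add: diff_divide_distrib)
  qed
  ultimately show ?thesis by (simp add: integral_unique)
qed

text \<open>
  The bound follows from \<open>sqrt (a0 + b) - sqrt b = a0 / (sqrt (a0 + b) + sqrt b)\<close>. Its denominator
  separates \<open>a0\<close> from \<open>b\<close>, so that the second summand becomes explicitly integrable in \<open>y\<close> when
  \<open>sqrt b\<close> is proportional to \<open>y\<close>.
\<close>

lemma sqrt_add_ge:
  fixes a a0 b :: real
  assumes "0 < a0" "a0 \<le> a" "0 \<le> b"
  shows "sqrt b + a0 / (sqrt a0 + 2 * sqrt b) \<le> sqrt (a + b)"
proof -
  have r: "sqrt (a0 + b) \<le> sqrt a0 + sqrt b" using assms by (intro sqrt_add_le_add_sqrt) auto
  have p: "0 < sqrt (a0 + b) + sqrt b" using assms by (intro add_pos_nonneg) auto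
  have "(sqrt (a0 + b) - sqrt b) * (sqrt (a0 + b) + sqrt b) = a0"
    using assms by (simp add: algebra_simps flip: power2_eq_square)
  then have "sqrt (a0 + b) - sqrt b = a0 / (sqrt (a0 + b) + sqrt b)"
    using p by (simp add: field_simps)
  also have "\<dots> \<ge> a0 / (sqrt a0 + 2 * sqrt b)"
    using r p assms by (intro divide_left_mono) (auto intro!: mult_pos_pos add_pos_nonneg)
  finally have "a0 / (sqrt a0 + 2 * sqrt b) \<le> sqrt (a0 + b) - sqrt b" .
  moreover have "sqrt (a0 + b) \<le> sqrt (a + b)" using assms by simp
  ultimately show ?thesis by linarith
qed

text \<open>
  A small enough move from a boundary point \<open>(0, t0)\<close> towards a point with positive first entry
  enlarges the wedge. By concavity the height drops at no point by more than \<open>u\<close>, since heights are at most \<open>1\<close>; this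
  costs at most \<open>4 u\<close> over the square. On a small box next to the first coordinate axis there is a gain of
  at least \<open>u \<kappa>\<^sup>2 / (sqrt u \<kappa> + 2 \<tau> y)\<close>, and its integral divided by \<open>u\<close> grows like \<open>ln (1 / u)\<close>.
\<close>

lemma wedge_integral_leaves_boundary:
  assumes "0 \<le> t0" "0 < s1" "0 \<le> t1"
  obtains u where "0 < u" "u \<le> 1"
    "wedge_integral (0, t0) < wedge_integral ((1 - u) *\<^sub>R (0, t0) + u *\<^sub>R (s1, t1))"
proof -
  \<comment> \<open>the box below lies in the square of side \<open>d\<close> at the origin, small enough for \<open>wedge_height_near_origin\<close>\<close>
  define d where "d = 1 / sqrt (2 + s1 + t0 + t1)"
  have d: "0 < d" "d \<le> 1" and d2: "d\<^sup>2 * (2 + s1 + t0 + t1) = 1"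
    using assms by (auto simp: d_def power_divide)
  \<comment> \<open>\<open>u \<kappa>\<^sup>2\<close> bounds \<open>u s1 x\<^sup>2\<close> from below on the box, where \<open>x \<ge> d / 2\<close>\<close>
  define \<kappa> where "\<kappa> = sqrt s1 * d / 2"
  \<comment> \<open>the summand \<open>1\<close> only keeps \<open>\<tau>\<close> positive when \<open>t0 = 0\<close>\<close>
  define \<tau> where "\<tau> = sqrt t0 + 1"
  have kt: "0 < \<kappa>" "0 < \<tau>" using assms d by (auto simp: \<kappa>_def \<tau>_def add_nonneg_pos)
  define c where "c = 2 * \<tau> * d / \<kappa>"
  \<comment> \<open>once the logarithm exceeds \<open>L\<close>, the gain on the box exceeds the cost \<open>4 u\<close>\<close>
  define L where "L = 16 * \<tau> / (\<kappa>\<^sup>2 * d)"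
  have c: "0 < c" using kt d by (simp add: c_def)
  define r where "r = min 1 (c / exp L)"
  have r: "0 < r" "r \<le> 1" using c by (auto simp: r_def)
  have "r * exp L \<le> c" by (simp add: r_def min_def field_simps)
  then have "exp L \<le> c / r" using r by (simp add: field_simps)
  then have "exp L < 1 + c / r" by linarith
  then have lnL: "L < ln (1 + c / r)"
    by (metis exp_gt_zero ln_exp ln_less_cancel_iff order_less_trans)
  define u where "u = r\<^sup>2"
  have u: "0 < u" "u \<le> 1" and su: "sqrt u = r" using r by (auto simp: u_def power_le_one)
  let ?k = "(0, t0) :: real \<times> real" and ?l = "(s1, t1)"
  let ?m = "(1 - u) *\<^sub>R ?k + u *\<^sub>R ?l"
  let ?Q = "cbox (-1, -1) (1, 1) :: (real \<times> real) set" and ?B = "cbox (d/2, 0) (d, d)"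
  \<comment> \<open>the summand \<open>u\<close> offsets the largest possible loss, so that \<open>f\<close> is nonnegative\<close>
  define f where "f p = wedge_height ?m p - wedge_height ?k p + u" for p
  define g where "g p = u * \<kappa>\<^sup>2 * (1 / (r * \<kappa> + 2 * \<tau> * snd p))" for p :: "real \<times> real"
  have f0: "0 \<le> f p" for p
  proof -
    have "(1 - u) * wedge_height ?k p + u * wedge_height ?l p \<le> wedge_height ?m p"
      using assms u by (intro wedge_height_concave) auto
    moreover have "0 \<le> u * wedge_height ?l p" using u assms by (simp add: wedge_height_nonneg)
    moreover have "u * wedge_height ?k p \<le> u"
      using u wedge_height_le_1[of ?k p] by (simp add: mult_left_le)
    ultimately show ?thesis by (simp add: f_def algebra_simps)
  qed
  have contf: "continuous_on S f" for S unfolding f_def by (intro continuous_intros)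
  have gf: "g p \<le> f p" if "p \<in> ?B" for p
  proof -
    obtain x y where p: "p = (x, y)" by fastforce
    have x: "d/2 \<le> x" "x \<le> d" and y: "0 \<le> y" "y \<le> d" using that by (auto simp: p cbox_Pair_eq)
    have x2: "(d/2)\<^sup>2 \<le> x\<^sup>2" "x\<^sup>2 \<le> d\<^sup>2" and y2: "y\<^sup>2 \<le> d\<^sup>2" using x y d by (auto intro!: power_mono)
    have small: "s * x\<^sup>2 + t * y\<^sup>2 \<le> 1 - x\<^sup>2 - y\<^sup>2" if st: "0 \<le> s" "0 \<le> t" "s + t \<le> s1 + t0 + t1" for s t
    proof -
      have "(s + 1) * x\<^sup>2 + (t + 1) * y\<^sup>2 \<le> (s + 1) * d\<^sup>2 + (t + 1) * d\<^sup>2"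
        using st x2 y2 by (intro add_mono mult_left_mono) auto
      also have "\<dots> = d\<^sup>2 * (2 + (s + t))" by (simp add: algebra_simps)
      also have "\<dots> \<le> d\<^sup>2 * (2 + (s1 + t0 + t1))" using st by (intro mult_left_mono) auto
      finally show ?thesis using d2 by (simp add: algebra_simps)
    qed
    have wk: "wedge_height ?k p = sqrt t0 * y"
      using wedge_height_near_origin[of ?k p] small[of 0 t0] assms y
      by (simp add: p real_sqrt_mult)
    have "u * s1 + ((1 - u) * t0 + u * t1) \<le> s1 + t0 + t1"
    proof -
      have "u * s1 \<le> s1" "(1 - u) * t0 \<le> t0" "u * t1 \<le> t1"
        using u assms by (auto simp: mult_left_le_one_le)
      then show ?thesis by linarith
    qed
    then have wm: "wedge_height ?m p = sqrt (u * s1 * x\<^sup>2 + ((1 - u) * t0 + u * t1) * y\<^sup>2)"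
      using wedge_height_near_origin[of ?m p] small[of "u * s1" "(1 - u) * t0 + u * t1"] assms u
      by (simp add: p)
    define b where "b = (1 - u) * t0 * y\<^sup>2"
    have b: "0 \<le> b" using u assms by (simp add: b_def)
    have sb: "sqrt b \<le> sqrt t0 * y"
    proof -
      have "b \<le> t0 * y\<^sup>2" using u assms unfolding b_def by (intro mult_right_mono mult_left_le_one_le) auto
      then have "sqrt b \<le> sqrt (t0 * y\<^sup>2)" by simp
      then show ?thesis using y by (simp add: real_sqrt_mult)
    qed
    have sb': "(1 - u) * (sqrt t0 * y) \<le> sqrt b"
    proof (rule real_le_rsqrt)
      have "(1 - u)\<^sup>2 \<le> 1 - u" using u by (simp add: power2_eq_square mult_left_le)
      then have "(1 - u)\<^sup>2 * (t0 * y\<^sup>2) \<le> (1 - u) * (t0 * y\<^sup>2)"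
        using assms by (intro mult_right_mono) auto
      moreover have "((1 - u) * (sqrt t0 * y))\<^sup>2 = (1 - u)\<^sup>2 * (t0 * y\<^sup>2)"
        using assms by (simp add: power_mult_distrib)
      ultimately show "((1 - u) * (sqrt t0 * y))\<^sup>2 \<le> b" by (simp add: b_def mult.assoc)
    qed
    have a0: "r\<^sup>2 * \<kappa>\<^sup>2 = u * s1 * (d/2)\<^sup>2"
      using assms by (simp add: \<kappa>_def u_def power_mult_distrib power_divide)
    have "sqrt b + (r\<^sup>2 * \<kappa>\<^sup>2) / (sqrt (r\<^sup>2 * \<kappa>\<^sup>2) + 2 * sqrt b) \<le> sqrt (u * s1 * x\<^sup>2 + b)"
    proof (rule sqrt_add_ge)
      show "r\<^sup>2 * \<kappa>\<^sup>2 \<le> u * s1 * x\<^sup>2"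
        unfolding a0 using x2 u assms by (intro mult_left_mono) auto
    qed (use r kt b in auto)
    also have "\<dots> \<le> wedge_height ?m p"
      using u assms unfolding wm b_def by (simp add: algebra_simps)
    finally have 1: "sqrt b + (u * \<kappa>\<^sup>2) / (r * \<kappa> + 2 * sqrt b) \<le> wedge_height ?m p"
      using r kt by (simp add: real_sqrt_mult u_def)
    have "sqrt t0 * y \<le> \<tau> * y" using y by (simp add: \<tau>_def algebra_simps)
    then have "g p \<le> (u * \<kappa>\<^sup>2) / (r * \<kappa> + 2 * sqrt b)"
      using sb r kt u y b unfolding g_def p
      by (auto intro!: divide_left_mono mult_pos_pos add_pos_nonneg)
    moreover have "u * (sqrt t0 * y) \<le> u"
      using wedge_height_le_1[of ?k p] wk u by (simp add: mult_left_le)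
    ultimately show ?thesis using 1 sb' unfolding f_def wk by (simp add: algebra_simps)
  qed
  have pos: "0 < r * \<kappa> + 2 * \<tau> * y" if "0 \<le> y" for y
    using r kt that by (simp add: add_pos_nonneg)
  have cg: "continuous_on ?B g"
    unfolding g_def using pos
    by (intro continuous_intros) (force simp: cbox_Pair_eq)
  have "u * 4 < u * \<kappa>\<^sup>2 * (d / 2) * (ln (1 + c / r) / (2 * \<tau>))"
  proof -
    have "4 = \<kappa>\<^sup>2 * (d / 2) * (L / (2 * \<tau>))" using kt d by (simp add: L_def field_simps)
    also have "\<dots> < \<kappa>\<^sup>2 * (d / 2) * (ln (1 + c / r) / (2 * \<tau>))"
      using lnL kt d by (intro mult_strict_left_mono divide_strict_right_mono) auto
    finally have "u * 4 < u * (\<kappa>\<^sup>2 * (d / 2) * (ln (1 + c / r) / (2 * \<tau>)))"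
      using u(1) by (rule mult_strict_left_mono)
    then show ?thesis by (simp only: mult.assoc)
  qed
  also have "\<dots> = integral ?B g"
  proof -
    have "integral ?B g = integral (cbox (d/2) d) (\<lambda>x. integral (cbox 0 d) (\<lambda>y. g (x, y)))"
      by (intro integral_prod_continuous cg)
    also have "\<dots> = u * \<kappa>\<^sup>2 * (d / 2) * integral {0..d} (\<lambda>y. 1 / (r * \<kappa> + 2 * \<tau> * y))"
    proof -
      have "integral (cbox 0 d) (\<lambda>y. g (x, y)) = u * \<kappa>\<^sup>2 * integral {0..d} (\<lambda>y. 1 / (r * \<kappa> + 2 * \<tau> * y))" for x
        by (simp only: g_def snd_conv integral_mult_right cbox_interval)
      then show ?thesis using d by simp
    qed
    also have "integral {0..d} (\<lambda>y. 1 / (r * \<kappa> + 2 * \<tau> * y)) = ln (1 + c / r) / (2 * \<tau>)"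
      using r kt d by (subst integral_inverse_affine) (auto simp: c_def field_simps)
    finally show ?thesis by simp
  qed
  also have "\<dots> \<le> integral ?B f"
  proof (rule integral_le)
    show "g integrable_on ?B"
      by (rule integrable_continuous[OF cg])
  qed (auto intro!: gf integrable_continuous contf)
  also have "\<dots> \<le> integral ?Q f"
    using d f0 by (intro integral_subset_le integrable_continuous contf) (auto simp: cbox_Pair_eq)
  also have "\<dots> = wedge_integral ?m - wedge_integral ?k + u * 4"
  proof -
    have "(f has_integral wedge_integral ?m - wedge_integral ?k + measure lborel ?Q *\<^sub>R u) ?Q"
      unfolding f_def wedge_integral_def
      by (intro has_integral_add has_integral_diff has_integral_const integrable_integral
          wedge_height_integrable)
    then show ?thesis by (simp add: integral_unique content_Pair)
  qed
  finally have "wedge_integral ?k < wedge_integral ?m" by simp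
  then show ?thesis using u that by blast
qed

text \<open>
  Compactness gives a maximum over the whole of \<open>F\<close>. It cannot lie on the boundary, since the segment
  from there to \<open>k1\<close> stays in \<open>F\<close> and starts with infinite slope; the second coordinate is treated
  by swapping the two. Two maxima would be beaten by their midpoint.
\<close>

lemma wedge_integral_unique_maximum:
  assumes "compact F" "convex F" and nonneg: "\<And>k. k \<in> F \<Longrightarrow> 0 \<le> fst k \<and> 0 \<le> snd k"
    and k1: "k1 \<in> F" "0 < fst k1" "0 < snd k1"
  shows "\<exists>!k. k \<in> F \<and> 0 < fst k \<and> 0 < snd k \<and>
    (\<forall>l\<in>F. 0 < fst l \<and> 0 < snd l \<longrightarrow> wedge_integral l \<le> wedge_integral k)"
proof -
  obtain k where k: "k \<in> F" and max: "\<And>l. l \<in> F \<Longrightarrow> wedge_integral l \<le> wedge_integral k"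
    using continuous_attains_sup[OF assms(1) _ continuous_on_wedge_integral] k1 by blast
  have seg: "(1 - u) *\<^sub>R k + u *\<^sub>R k1 \<in> F" if "0 < u" "u \<le> 1" for u
    using that k k1 by (intro convexD[OF assms(2)]) auto
  have "fst k \<noteq> 0"
  proof
    assume "fst k = 0"
    then have "k = (0, snd k)" by (simp add: prod_eq_iff)
    then obtain u where u: "0 < u" "u \<le> 1"
      "wedge_integral k < wedge_integral ((1 - u) *\<^sub>R k + u *\<^sub>R k1)"
      using wedge_integral_leaves_boundary[of "snd k" "fst k1" "snd k1"] nonneg[OF k] k1
      by (metis less_imp_le prod.collapse)
    then show False using max[OF seg] by fastforce
  qed
  moreover have "snd k \<noteq> 0"
  proof
    assume "snd k = 0"
    obtain u where u: "0 < u" "u \<le> 1"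
      "wedge_integral (0, fst k) < wedge_integral ((1 - u) *\<^sub>R (0, fst k) + u *\<^sub>R (snd k1, fst k1))"
      using wedge_integral_leaves_boundary[of "fst k" "snd k1" "fst k1"] nonneg[OF k] k1
      by (metis less_imp_le)
    moreover have "(1 - u) *\<^sub>R (0, fst k) + u *\<^sub>R (snd k1, fst k1) = prod.swap ((1 - u) *\<^sub>R k + u *\<^sub>R k1)"
      "(0, fst k) = prod.swap k"
      using \<open>snd k = 0\<close> by (simp_all add: prod_eq_iff)
    ultimately have "wedge_integral k < wedge_integral ((1 - u) *\<^sub>R k + u *\<^sub>R k1)"
      by (simp only: wedge_integral_swap)
    then show False using max[OF seg] u by fastforce
  qed
  ultimately have pos: "0 < fst k" "0 < snd k" using nonneg[OF k] by auto
  have uniq: "k' = k" if "k' \<in> F" "\<forall>l\<in>F. 0 < fst l \<and> 0 < snd l \<longrightarrow> wedge_integral l \<le> wedge_integral k'" for k'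
  proof (rule ccontr)
    assume "k' \<noteq> k"
    then have "(wedge_integral k' + wedge_integral k) / 2
        < wedge_integral ((1/2) *\<^sub>R k' + (1/2) *\<^sub>R k)"
      using nonneg k that by (intro wedge_integral_midpoint_strict) auto
    moreover have "(1/2) *\<^sub>R k' + (1/2) *\<^sub>R k \<in> F" using that k by (intro convexD[OF assms(2)]) auto
    ultimately have "wedge_integral k' < wedge_integral k" using max by fastforce
    then show False using that(2) k pos by fastforce
  qed
  show ?thesis
  proof (rule ex1I[of _ k])
    fix k' assume "k' \<in> F \<and> 0 < fst k' \<and> 0 < snd k' \<and>
      (\<forall>l\<in>F. 0 < fst l \<and> 0 < snd l \<longrightarrow> wedge_integral l \<le> wedge_integral k')"
    then show "k' = k" by (intro uniq) auto
  qed (use k pos max in auto)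
qed

section \<open>The volume of the wedge\<close>

text \<open>
  The coordinates are grouped so that Fubini's theorem can integrate the vertical slices over the
  horizontal plane.
\<close>

definition vec3_of :: "(real \<times> real) \<times> real \<Rightarrow> real^3" where
  "vec3_of v = vector [fst (fst v), snd (fst v), snd v]"

lemma vec3_of_nth [simp]:
  "vec3_of v $ 1 = fst (fst v)" "vec3_of v $ 2 = snd (fst v)" "vec3_of v $ 3 = snd v"
  by (simp_all add: vec3_of_def)

lemma vec3_of_measurable [measurable]: "vec3_of \<in> borel_measurable borel"
proof (rule borel_measurable_continuous_onI)
  have "continuous_on UNIV (\<lambda>v. \<chi> i. vec3_of v $ i)"
  proof (intro continuous_on_vec_lambda)
    fix i :: 3
    show "continuous_on UNIV (\<lambda>v. vec3_of v $ i)"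
      using exhaust_3[of i] by (elim disjE; simp) (intro continuous_intros)+
  qed
  then show "continuous_on UNIV vec3_of" by simp
qed

text \<open>
  Lebesgue measure is determined by its values on boxes, and \<open>vec3_of\<close> matches boxes with boxes.
\<close>

lemma lborel_eq_distr_vec3_of: "lborel = distr lborel borel vec3_of"
proof (rule lborel_eqI)
  fix l u :: "real^3"
  assume le: "\<And>b. b \<in> Basis \<Longrightarrow> l \<bullet> b \<le> u \<bullet> b"
  have le': "l $ i \<le> u $ i" for i using le[of "axis i 1"] by (simp add: inner_axis)
  have "vec3_of -` box l u = box ((l$1, l$2), l$3) ((u$1, u$2), u$3)"
    by (auto simp: mem_box Basis_vec_def Basis_prod_def inner_axis forall_3 vec3_of_def)
  then have "emeasure (distr lborel borel vec3_of) (box l u)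
      = emeasure lborel (box ((l$1, l$2), l$3) ((u$1, u$2), u$3))"
    by (subst emeasure_distr) (auto simp: )
  also have "\<dots> = ennreal (\<Prod>b\<in>Basis. (((u$1, u$2), u$3) - ((l$1, l$2), l$3)) \<bullet> b)"
    using le' by (intro emeasure_lborel_box) (auto simp: Basis_prod_def)
  also have "(\<Prod>b\<in>Basis. (((u$1, u$2), u$3) - ((l$1, l$2), l$3)) \<bullet> b)
      = (u$1 - l$1) * (u$2 - l$2) * (u$3 - l$3)"
  proof -
    have B: "(Basis :: ((real\<times>real)\<times>real) set) = {((1,0),0), ((0,1),0), ((0,0),1)}"
      by (auto simp: Basis_prod_def zero_prod_def)
    show ?thesis unfolding B by simp
  qed
  also have "\<dots> = (\<Prod>b\<in>Basis. (u - l) \<bullet> b)"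
  proof -
    have B: "(Basis :: (real^3) set) = {axis 1 1, axis 2 1, axis 3 1}"
      by (auto simp: Basis_vec_def UNIV_3)
    show ?thesis unfolding B by (simp add: inner_axis axis_eq_axis)
  qed
  finally show "emeasure (distr lborel borel vec3_of) (box l u) = ennreal (\<Prod>b\<in>Basis. (u - l) \<bullet> b)" .
qed simp

lemma wedge_height_eq_0:
  assumes "0 \<le> fst k" "0 \<le> snd k" "p \<notin> cbox (-1, -1) (1, 1)"
  shows "wedge_height k p = 0"
proof -
  have "1 < \<bar>fst p\<bar> \<or> 1 < \<bar>snd p\<bar>"
    using assms(3) by (cases p) (auto simp: cbox_Pair_eq)
  then have "1 < (fst p)\<^sup>2 \<or> 1 < (snd p)\<^sup>2" by (metis abs_one abs_square_less_1 linorder_not_le abs_le_square_iff one_power2 less_le)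
  then have "1 < (fst p)\<^sup>2 + (snd p)\<^sup>2" by (smt (verit) zero_le_power2)
  then show ?thesis using assms by (simp add: wedge_height_def max_absorb1)
qed

lemma emeasure_wedge_slice:
  assumes "0 \<le> fst k" "0 \<le> snd k"
  shows "emeasure lborel {z. z\<^sup>2 < fst k * x\<^sup>2 + snd k * y\<^sup>2 \<and> x\<^sup>2 + y\<^sup>2 + z\<^sup>2 \<le> 1}
    = ennreal (2 * wedge_height k (x, y))"
proof (cases "x\<^sup>2 + y\<^sup>2 \<le> 1")
  case False
  have "{z. z\<^sup>2 < fst k * x\<^sup>2 + snd k * y\<^sup>2 \<and> x\<^sup>2 + y\<^sup>2 + z\<^sup>2 \<le> 1} = {}"
    using False by (auto simp: not_le) (smt (verit) zero_le_power2)
  moreover have "wedge_height k (x, y) = 0"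
    using False assms by (simp add: wedge_height_def max_absorb1)
  ultimately show ?thesis by (simp only: emeasure_empty) simp
next
  case True
  define \<alpha> where "\<alpha> = sqrt (fst k * x\<^sup>2 + snd k * y\<^sup>2)"
  define \<beta> where "\<beta> = sqrt (1 - x\<^sup>2 - y\<^sup>2)"
  have nn: "0 \<le> \<alpha>" "0 \<le> \<beta>" using assms True by (auto simp: \<alpha>_def \<beta>_def)
  have w: "wedge_height k (x, y) = min \<alpha> \<beta>"
    using True by (simp add: wedge_height_def \<alpha>_def \<beta>_def max_absorb2)
  have "z\<^sup>2 < fst k * x\<^sup>2 + snd k * y\<^sup>2 \<longleftrightarrow> \<bar>z\<bar> < \<alpha>" for z
    by (metis \<alpha>_def real_sqrt_abs real_sqrt_less_iff)
  moreover have "x\<^sup>2 + y\<^sup>2 + z\<^sup>2 \<le> 1 \<longleftrightarrow> \<bar>z\<bar> \<le> \<beta>" for z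
  proof -
    have "x\<^sup>2 + y\<^sup>2 + z\<^sup>2 \<le> 1 \<longleftrightarrow> z\<^sup>2 \<le> 1 - x\<^sup>2 - y\<^sup>2" by linarith
    then show ?thesis by (metis \<beta>_def real_sqrt_abs real_sqrt_le_iff)
  qed
  ultimately have "{z. z\<^sup>2 < fst k * x\<^sup>2 + snd k * y\<^sup>2 \<and> x\<^sup>2 + y\<^sup>2 + z\<^sup>2 \<le> 1}
      = (if \<alpha> \<le> \<beta> then {-\<alpha><..<\<alpha>} else {-\<beta>..\<beta>})"
    by auto
  then show ?thesis using nn by (simp add: w min_def)
qed

text \<open>
  Fubini's theorem: the vertical slices of the wedge are intervals around \<open>0\<close> of half-length
  \<open>wedge_height k\<close>.
\<close>

lemma measure_wedge:
  assumes k: "0 \<le> fst k" "0 \<le> snd k"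
  shows "measure lebesgue {x::real^3. norm x \<le> 1 \<and> (x$3)\<^sup>2 < fst k * (x$1)\<^sup>2 + snd k * (x$2)\<^sup>2}
    = 2 * wedge_integral k"
proof -
  let ?W = "{x::real^3. norm x \<le> 1 \<and> (x$3)\<^sup>2 < fst k * (x$1)\<^sup>2 + snd k * (x$2)\<^sup>2}"
  let ?V = "vec3_of -` ?W"
  have W [measurable]: "?W \<in> sets borel" by measurable
  have V [measurable]: "?V \<in> sets borel"
    using measurable_sets_borel[OF vec3_of_measurable W] .
  have slice: "Pair (x, y) -` ?V = {z. z\<^sup>2 < fst k * x\<^sup>2 + snd k * y\<^sup>2 \<and> x\<^sup>2 + y\<^sup>2 + z\<^sup>2 \<le> 1}" for x y
    by (auto simp: norm_vec_def L2_set_def sum_3)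
  have "((\<lambda>p. 2 * wedge_height k p) has_integral 2 * wedge_integral k) (cbox (-1, -1) (1, 1))"
    unfolding wedge_integral_def
    by (intro has_integral_mult_right integrable_integral wedge_height_integrable)
  then have int: "((\<lambda>p. 2 * wedge_height k p) has_integral 2 * wedge_integral k) UNIV"
    by (rule has_integral_on_superset) (auto simp: wedge_height_eq_0 k)
  have "emeasure lborel ?W = emeasure (distr lborel borel vec3_of) ?W"
    using lborel_eq_distr_vec3_of by simp
  also have "\<dots> = emeasure (lborel \<Otimes>\<^sub>M lborel) ?V"
    by (subst emeasure_distr) (auto simp: lborel_prod)
  also have "\<dots> = (\<integral>\<^sup>+p. emeasure lborel (Pair p -` ?V) \<partial>lborel)"
    by (rule lborel.emeasure_pair_measure_alt) (use V in \<open>simp only: lborel_prod sets_lborel\<close>)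
  also have "\<dots> = (\<integral>\<^sup>+p. ennreal (2 * wedge_height k p) \<partial>lborel)"
  proof (rule nn_integral_cong)
    fix p
    show "emeasure lborel (Pair p -` ?V) = ennreal (2 * wedge_height k p)"
      by (cases p) (simp only: slice emeasure_wedge_slice[OF k])
  qed
  also have "\<dots> = ennreal (2 * wedge_integral k)"
    using int wedge_height_nonneg[OF k]
    by (intro nn_integral_has_integral_lborel borel_measurable_continuous_onI continuous_intros) auto
  finally have "emeasure lborel ?W = ennreal (2 * wedge_integral k)" .
  moreover have "0 \<le> wedge_integral k"
    unfolding wedge_integral_def
    by (intro integral_nonneg wedge_height_integrable wedge_height_nonneg k)
  ultimately show ?thesis using W by (simp add: measure_def)
qed

section \<open>Orthonormal frames\<close>

text \<open>
  In the application \<open>e3\<close> spans the center of the conics, and \<open>e1\<close>, \<open>e2\<close> are the poles of the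
  two axes \<open>Y\<close> and \<open>X\<close>.
\<close>

locale orthonormal_frame =
  fixes e1 e2 e3 :: "real^3"
  assumes unit [simp]: "e1 \<bullet> e1 = 1" "e2 \<bullet> e2 = 1" "e3 \<bullet> e3 = 1"
    and ortho: "e1 \<bullet> e2 = 0" "e1 \<bullet> e3 = 0" "e2 \<bullet> e3 = 0"
begin

lemma ortho_simps [simp]:
  "e1 \<bullet> e2 = 0" "e1 \<bullet> e3 = 0" "e2 \<bullet> e3 = 0" "e2 \<bullet> e1 = 0" "e3 \<bullet> e1 = 0" "e3 \<bullet> e2 = 0"
  using ortho by (simp_all add: inner_commute)

lemma frame_nonzero [simp]: "e1 \<noteq> 0" "e2 \<noteq> 0" "e3 \<noteq> 0"
  using unit by force+

definition coord :: "real^3^3" where "coord = vector [e1, e2, e3]"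

lemma coord_nth [simp]:
  "(coord *v x) $ 1 = e1 \<bullet> x" "(coord *v x) $ 2 = e2 \<bullet> x" "(coord *v x) $ 3 = e3 \<bullet> x"
  by (simp_all add: coord_def matrix_vector_mul_component)

lemma coord_transpose: "coord ** transpose coord = mat 1"
proof -
  have "(coord ** transpose coord) $ i $ j = coord $ i \<bullet> coord $ j" for i j
    by (simp add: matrix_matrix_mult_def transpose_def inner_vec_def)
  then have "(coord ** transpose coord) $ i $ j = mat 1 $ i $ j" for i j
    using exhaust_3[of i] exhaust_3[of j] by (auto simp: coord_def mat_def)
  then show ?thesis by (simp add: vec_eq_iff)
qed

lemma transpose_coord: "transpose coord ** coord = mat 1"
  using coord_transpose matrix_left_right_inverse by blast

lemma orthogonal_matrix_coord: "orthogonal_matrix coord"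
  by (simp add: orthogonal_matrix_def coord_transpose transpose_coord)

lemma coord_inverse [simp]: "(coord *v x) v* coord = x" "coord *v (x v* coord) = x"
  by (metis matrix_vector_mul_assoc transpose_matrix_vector transpose_coord coord_transpose
      matrix_vector_mul_lid)+

lemma frame_eqI:
  assumes "e1 \<bullet> x = e1 \<bullet> y" "e2 \<bullet> x = e2 \<bullet> y" "e3 \<bullet> x = e3 \<bullet> y"
  shows "x = y"
proof -
  have "coord *v x = coord *v y" using assms by (simp add: vec_eq_iff forall_3)
  then show ?thesis by (metis coord_inverse(1))
qed

lemma frame_expand: "x = (e1 \<bullet> x) *\<^sub>R e1 + (e2 \<bullet> x) *\<^sub>R e2 + (e3 \<bullet> x) *\<^sub>R e3"
  by (rule frame_eqI) (simp_all add: inner_add_right)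

lemma inner_frame: "x \<bullet> y = (e1 \<bullet> x) * (e1 \<bullet> y) + (e2 \<bullet> x) * (e2 \<bullet> y) + (e3 \<bullet> x) * (e3 \<bullet> y)"
  by (subst frame_expand[of x]) (simp add: inner_add_left)

text \<open>
  The change to frame coordinates is orthogonal and so preserves volume; in these coordinates the cone
  is the complement of the wedge in the unit ball.
\<close>

lemma measure_cone:
  assumes "0 \<le> fst k" "0 \<le> snd k"
  shows "measure lebesgue {x. norm x \<le> 1 \<and> fst k * (e1 \<bullet> x)\<^sup>2 + snd k * (e2 \<bullet> x)\<^sup>2 \<le> (e3 \<bullet> x)\<^sup>2}
    = 4 / 3 * pi - 2 * wedge_integral k"
proof -
  let ?C = "{x. norm x \<le> 1 \<and> fst k * (e1 \<bullet> x)\<^sup>2 + snd k * (e2 \<bullet> x)\<^sup>2 \<le> (e3 \<bullet> x)\<^sup>2}"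
  let ?W = "{x::real^3. norm x \<le> 1 \<and> (x$3)\<^sup>2 < fst k * (x$1)\<^sup>2 + snd k * (x$2)\<^sup>2}"
  have orth: "orthogonal_transformation ((\<lambda>x. x v* coord))"
    unfolding transpose_matrix_vector[symmetric]
    by (simp only: orthogonal_transformation_matrix matrix_vector_mul_linear
        matrix_of_matrix_vector_mul orthogonal_matrix_transpose orthogonal_matrix_coord)
  have image: "?C = (\<lambda>x. x v* coord) ` (cball 0 1 - ?W)"
  proof (intro equalityI subsetI)
    fix x assume "x \<in> ?C"
    then have "coord *v x \<in> cball 0 1 - ?W"
      using orthogonal_transformation_norm[OF orth, of "coord *v x"]
      by auto
    then show "x \<in> (\<lambda>x. x v* coord) ` (cball 0 1 - ?W)"
      by (intro image_eqI[of _ _ "coord *v x"]) auto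
  next
    fix x assume "x \<in> (\<lambda>x. x v* coord) ` (cball 0 1 - ?W)"
    then obtain y where y: "y \<in> cball 0 1 - ?W" and x: "x = y v* coord" by blast
    have "coord *v x = y" using x by simp
    then have "e1 \<bullet> x = y $ 1" "e2 \<bullet> x = y $ 2" "e3 \<bullet> x = y $ 3" by (metis coord_nth)+
    moreover have "norm x = norm y" using orthogonal_transformation_norm[OF orth] x by simp
    ultimately show "x \<in> ?C" using y by auto
  qed
  have W: "?W \<in> lmeasurable"
  proof (rule bounded_set_imp_lmeasurable)
    show "bounded ?W" by (rule bounded_subset[of "cball 0 1"]) auto
    have "?W \<in> sets borel" by measurable
    then show "?W \<in> sets lebesgue" by simp
  qed
  have "measure lebesgue ?C = measure lebesgue (cball 0 1 - ?W)"
    unfolding image using W by (intro measure_orthogonal_image orth fmeasurable.Diff) auto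
  also have "\<dots> = measure lebesgue (cball (0::real^3) 1) - measure lebesgue ?W"
    using W by (intro measurable_measure_Diff) (auto simp: fmeasurableD)
  also have "\<dots> = 4 / 3 * pi - 2 * wedge_integral k"
    using measure_wedge[OF assms] by (simp add: content_cball unit_ball_vol_3)
  finally show ?thesis .
qed

definition frame_conic :: "real \<Rightarrow> real \<Rightarrow> (real^3) set" where
  "frame_conic a b = {x \<in> sphere 0 1. a * (e1 \<bullet> x)\<^sup>2 + b * (e2 \<bullet> x)\<^sup>2 = (e3 \<bullet> x)\<^sup>2}"

definition diag3 :: "real \<Rightarrow> real \<Rightarrow> real \<Rightarrow> real^3^3" where
  "diag3 a b c = (\<chi> i j. if i = j then (if i = 1 then a else if i = 2 then b else c) else 0)"

definition frame_conic_matrix :: "real \<Rightarrow> real \<Rightarrow> real^3^3" where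
  "frame_conic_matrix a b = transpose coord ** diag3 a b (- 1) ** coord"

end

section \<open>Lines that meet a conic at most once\<close>

lemma ell_point_unit: "norm x = 1 \<Longrightarrow> ell_point x = {x, - x}"
  by (simp add: ell_point_def sgn_div_norm)

lemma ell_point_eq_iff:
  assumes "norm x = 1" "norm y = 1"
  shows "ell_point x = ell_point y \<longleftrightarrow> x = y \<or> x = - y"
  using assms by (auto simp: ell_point_unit doubleton_eq_iff)

definition line_of_normal :: "real^3 \<Rightarrow> (real^3) set set" where
  "line_of_normal n = line_of_plane {x. n \<bullet> x = 0}"

lemma line_of_normal_in_elliptic_lines:
  "n \<noteq> 0 \<Longrightarrow> line_of_normal n \<in> elliptic_lines"
  unfolding elliptic_lines_def line_of_normal_def
  by (intro imageI) (simp add: subspace_hyperplane dim_hyperplane)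

lemma abs_pole_line_of_normal:
  "n \<noteq> 0 \<Longrightarrow> abs_pole (line_of_normal n) = ell_point n"
  unfolding line_of_normal_def
  by (rule abs_pole_line_of_plane) (simp_all add: subspace_hyperplane dim_hyperplane)

lemma ell_point_in_line_of_normal:
  assumes "norm x = 1"
  shows "ell_point x \<in> line_of_normal n \<longleftrightarrow> n \<bullet> x = 0"
proof
  assume "ell_point x \<in> line_of_normal n"
  then obtain y where "norm y = 1" "n \<bullet> y = 0" "ell_point x = ell_point y"
    by (auto simp: line_of_normal_def line_of_plane_def)
  then show "n \<bullet> x = 0" using assms by (auto simp: ell_point_eq_iff)
next
  assume "n \<bullet> x = 0"
  then show "ell_point x \<in> line_of_normal n"
    using assms by (auto simp: line_of_normal_def line_of_plane_def)
qed

lemma elliptic_line_obtain_normal: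
  assumes "K \<in> elliptic_lines"
  obtains n where "norm n = 1" "K = line_of_normal n" "abs_pole K = {n, - n}"
proof -
  obtain S where S: "subspace S" "dim S = 2" "K = line_of_plane S"
    using assms by (auto simp: elliptic_lines_def)
  obtain m where m: "m \<noteq> 0" "\<And>y. y \<in> span S \<Longrightarrow> orthogonal m y"
    using orthogonal_to_subspace_exists[of S] S by auto
  define n where "n = sgn m"
  have n: "norm n = 1" "n \<noteq> 0" using m by (auto simp: n_def norm_sgn sgn_zero_iff)
  have "S \<subseteq> {x. n \<bullet> x = 0}"
    using m by (auto simp: n_def sgn_div_norm orthogonal_def span_base)
  then have "S = {x. n \<bullet> x = 0}"
    using S n by (intro subspace_dim_equal) (auto simp: subspace_hyperplane dim_hyperplane)
  then have K: "K = line_of_normal n" using S by (simp add: line_of_normal_def)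
  then show ?thesis using n that abs_pole_line_of_normal[of n] ell_point_unit[of n] by auto
qed

text \<open>
  A line in the closed dual region touches the conic or avoids it: Lagrange's identity turns the
  incidence of \<open>x\<close> with the line and with the conic into
  \<open>a b (n1\<^sup>2 / a + n2\<^sup>2 / b - n3\<^sup>2) x3\<^sup>2 = (b n1 x2 - a n2 x1)\<^sup>2\<close>, where the left side is at most \<open>0\<close>. So
  both sides vanish, and \<open>x\<close> is proportional to the pole of the line with respect to the conic.
\<close>

lemma tangent_point_unique:
  fixes a b n1 n2 n3 x1 x2 x3 :: real
  assumes ab: "0 < a" "0 < b"
    and dual: "n1\<^sup>2 / a + n2\<^sup>2 / b \<le> n3\<^sup>2"
    and cone: "a * x1\<^sup>2 + b * x2\<^sup>2 = x3\<^sup>2"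
    and inc: "n1 * x1 + n2 * x2 + n3 * x3 = 0"
  shows "a * n3 * x1 = - (n1 * x3)" "b * n3 * x2 = - (n2 * x3)"
proof -
  have "a * n3 * x1 = - (n1 * x3) \<and> b * n3 * x2 = - (n2 * x3)"
  proof (cases "x3 = 0")
    case True
    then have "a * x1\<^sup>2 = 0" "b * x2\<^sup>2 = 0"
      using cone ab by (simp_all add: add_nonneg_eq_0_iff)
    then show ?thesis using ab True by simp
  next
    case False
    define N where "N = n1\<^sup>2 / a + n2\<^sup>2 / b"
    have N: "a * b * N = b * n1\<^sup>2 + a * n2\<^sup>2" using ab by (simp add: N_def field_simps)
    have p: "n1 * x1 + n2 * x2 = - (n3 * x3)" using inc by linarith
    have "a * b * N * (a * x1\<^sup>2 + b * x2\<^sup>2)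
        = a * b * (n1 * x1 + n2 * x2)\<^sup>2 + (b * n1 * x2 - a * n2 * x1)\<^sup>2"
      unfolding N by (simp add: power2_eq_square algebra_simps)
    then have lag: "a * b * (N - n3\<^sup>2) * x3\<^sup>2 = (b * n1 * x2 - a * n2 * x1)\<^sup>2"
      unfolding cone p by (simp add: power2_eq_square algebra_simps)
    have "N \<le> n3\<^sup>2" using dual by (simp add: N_def)
    then have "a * b * (N - n3\<^sup>2) * x3\<^sup>2 \<le> 0" using ab by (simp add: mult_nonneg_nonpos mult_nonpos_nonneg)
    then have "(b * n1 * x2 - a * n2 * x1)\<^sup>2 = 0" using lag by (metis order_antisym zero_le_power2)
    then have cr: "b * n1 * x2 = a * n2 * x1" and "N = n3\<^sup>2" using lag ab False by auto
    then have ab3: "a * b * n3\<^sup>2 = b * n1\<^sup>2 + a * n2\<^sup>2" using N by simp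
    show ?thesis
    proof (cases "n3 = 0")
      case True
      then have "b * n1\<^sup>2 = 0" "a * n2\<^sup>2 = 0" using ab3 ab by (simp_all add: add_nonneg_eq_0_iff)
      then show ?thesis using ab True by simp
    next
      case n3: False
      have "a * b * n3\<^sup>2 * x1 = b * n1 * (n1 * x1 + n2 * x2)"
        unfolding ab3 using cr by (simp add: power2_eq_square algebra_simps)
      then have "b * n3 * (a * n3 * x1) = b * n3 * (- (n1 * x3))"
        unfolding p by (simp add: power2_eq_square algebra_simps)
      moreover have "a * b * n3\<^sup>2 * x2 = a * n2 * (n1 * x1 + n2 * x2)"
        unfolding ab3 using cr by (simp add: power2_eq_square algebra_simps)
      then have "a * n3 * (b * n3 * x2) = a * n3 * (- (n2 * x3))"
        unfolding p by (simp add: power2_eq_square algebra_simps)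
      ultimately show ?thesis using ab n3 by (simp only: mult_cancel_left) auto
    qed
  qed
  then show "a * n3 * x1 = - (n1 * x3)" "b * n3 * x2 = - (n2 * x3)" by auto
qed

text \<open>
  Outside the dual region the two signs of the square root \<open>h\<close> yield two common points. Among
  the points of the line with third coordinate \<open>x3\<close>, the one with first coordinates
  \<open>(- n3 n1 / a, - n3 n2 / b)\<close> minimizes \<open>a x1\<^sup>2 + b x2\<^sup>2\<close>; the summands with \<open>h\<close> move it along the
  line until it reaches the conic.
\<close>

lemma secant_point:
  fixes a b n1 n2 n3 h :: real
  assumes ab: "0 < a" "0 < b"
    and h: "h\<^sup>2 = n1\<^sup>2 / a + n2\<^sup>2 / b - n3\<^sup>2"
    and x: "x1 = - n3 * n1 / a + h * n2 / sqrt (a * b)"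
      "x2 = - n3 * n2 / b - h * n1 / sqrt (a * b)" "x3 = n1\<^sup>2 / a + n2\<^sup>2 / b"
  shows "a * x1\<^sup>2 + b * x2\<^sup>2 = x3\<^sup>2" "n1 * x1 + n2 * x2 + n3 * x3 = 0"
proof -
  define D where "D = sqrt (a * b)"
  have D: "D \<noteq> 0" and D2: "D\<^sup>2 = a * b" using ab by (auto simp: D_def)
  have "a * x1\<^sup>2 + b * x2\<^sup>2 = n3\<^sup>2 * (n1\<^sup>2 / a + n2\<^sup>2 / b) + h\<^sup>2 * (a * n2\<^sup>2 + b * n1\<^sup>2) / D\<^sup>2"
    unfolding x D_def[symmetric] using ab D by (simp add: power2_eq_square field_simps)
  also have "(a * n2\<^sup>2 + b * n1\<^sup>2) / D\<^sup>2 = x3"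
    unfolding D2 x using ab by (simp add: field_simps)
  then have "h\<^sup>2 * (a * n2\<^sup>2 + b * n1\<^sup>2) / D\<^sup>2 = (x3 - n3\<^sup>2) * x3"
    unfolding times_divide_eq_right[symmetric] h x(3) by simp
  also have "n3\<^sup>2 * (n1\<^sup>2 / a + n2\<^sup>2 / b) + (x3 - n3\<^sup>2) * x3 = x3\<^sup>2"
    unfolding x(3) by (simp add: power2_eq_square algebra_simps)
  finally show "a * x1\<^sup>2 + b * x2\<^sup>2 = x3\<^sup>2" .
  show "n1 * x1 + n2 * x2 + n3 * x3 = 0"
    unfolding x by (simp add: power2_eq_square algebra_simps)
qed

lemma symmetric_eigenvectors_orthogonal:
  fixes M :: "real^'n^'n"
  assumes "transpose M = M" "M *v x = \<alpha> *\<^sub>R x" "M *v y = \<beta> *\<^sub>R y" "\<alpha> \<noteq> \<beta>"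
  shows "x \<bullet> y = 0"
proof -
  have "(M *v x) \<bullet> y = x \<bullet> (M *v y)"
    by (metis assms(1) dot_lmul_matrix transpose_matrix_vector)
  then have "(\<alpha> - \<beta>) * (x \<bullet> y) = 0" by (simp add: assms(2,3) algebra_simps)
  then show ?thesis using assms(4) by simp
qed

context orthonormal_frame
begin

lemma meets_at_most_once_frame_conic:
  assumes ab: "0 < a" "0 < b" and n: "n \<noteq> 0"
  shows "meets_at_most_once (line_of_normal n) (frame_conic a b) \<longleftrightarrow>
    (e1 \<bullet> n)\<^sup>2 / a + (e2 \<bullet> n)\<^sup>2 / b \<le> (e3 \<bullet> n)\<^sup>2"
proof
  assume dual: "(e1 \<bullet> n)\<^sup>2 / a + (e2 \<bullet> n)\<^sup>2 / b \<le> (e3 \<bullet> n)\<^sup>2"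
  have n3: "e3 \<bullet> n \<noteq> 0"
  proof
    assume "e3 \<bullet> n = 0"
    then have "(e1 \<bullet> n)\<^sup>2 / a + (e2 \<bullet> n)\<^sup>2 / b \<le> 0" using dual by simp
    moreover have "0 \<le> (e1 \<bullet> n)\<^sup>2 / a" "0 \<le> (e2 \<bullet> n)\<^sup>2 / b" using ab by auto
    ultimately have "(e1 \<bullet> n)\<^sup>2 / a = 0" "(e2 \<bullet> n)\<^sup>2 / b = 0" by linarith+
    then have "n = 0" using \<open>e3 \<bullet> n = 0\<close> ab by (intro frame_eqI) auto
    then show False using n by simp
  qed
  have point: "\<exists>x. P = ell_point x \<and> norm x = 1 \<and> e3 \<bullet> x \<noteq> 0 \<and>
      a * (e3 \<bullet> n) * (e1 \<bullet> x) = - ((e1 \<bullet> n) * (e3 \<bullet> x)) \<and>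
      b * (e3 \<bullet> n) * (e2 \<bullet> x) = - ((e2 \<bullet> n) * (e3 \<bullet> x))"
    if P: "P \<in> line_of_normal n \<inter> ell_point ` frame_conic a b" for P
  proof -
    obtain x where x: "x \<in> frame_conic a b" "P = ell_point x" using P by auto
    then have unit: "norm x = 1" by (simp add: frame_conic_def)
    then have "n \<bullet> x = 0" using P x ell_point_in_line_of_normal by auto
    then have inc: "(e1 \<bullet> n) * (e1 \<bullet> x) + (e2 \<bullet> n) * (e2 \<bullet> x) + (e3 \<bullet> n) * (e3 \<bullet> x) = 0"
      by (simp add: inner_frame[of n x])
    have cone: "a * (e1 \<bullet> x)\<^sup>2 + b * (e2 \<bullet> x)\<^sup>2 = (e3 \<bullet> x)\<^sup>2" using x by (simp add: frame_conic_def)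
    have t: "a * (e3 \<bullet> n) * (e1 \<bullet> x) = - ((e1 \<bullet> n) * (e3 \<bullet> x))"
      "b * (e3 \<bullet> n) * (e2 \<bullet> x) = - ((e2 \<bullet> n) * (e3 \<bullet> x))"
      using tangent_point_unique[OF ab dual cone inc] by auto
    have "e3 \<bullet> x \<noteq> 0"
    proof
      assume z: "e3 \<bullet> x = 0"
      then have "x = 0" using t ab n3 by (intro frame_eqI) auto
      then show False using unit by simp
    qed
    then show ?thesis using t unit x by blast
  qed
  show "meets_at_most_once (line_of_normal n) (frame_conic a b)"
    unfolding meets_at_most_once_def
  proof (intro ballI)
    fix P Q assume "P \<in> line_of_normal n \<inter> ell_point ` frame_conic a b"
      "Q \<in> line_of_normal n \<inter> ell_point ` frame_conic a b"
    then obtain x y where x: "P = ell_point x" "e3 \<bullet> x \<noteq> 0"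
        "a * (e3 \<bullet> n) * (e1 \<bullet> x) = - ((e1 \<bullet> n) * (e3 \<bullet> x))"
        "b * (e3 \<bullet> n) * (e2 \<bullet> x) = - ((e2 \<bullet> n) * (e3 \<bullet> x))"
      and y: "Q = ell_point y" "e3 \<bullet> y \<noteq> 0"
        "a * (e3 \<bullet> n) * (e1 \<bullet> y) = - ((e1 \<bullet> n) * (e3 \<bullet> y))"
        "b * (e3 \<bullet> n) * (e2 \<bullet> y) = - ((e2 \<bullet> n) * (e3 \<bullet> y))"
      using point by meson
    have "a * (e3 \<bullet> n) * ((e3 \<bullet> y) * (e1 \<bullet> x)) = a * (e3 \<bullet> n) * ((e3 \<bullet> x) * (e1 \<bullet> y))"
      using arg_cong[OF x(3), of "\<lambda>v. (e3 \<bullet> y) * v"] arg_cong[OF y(3), of "\<lambda>v. (e3 \<bullet> x) * v"]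
      by (simp add: algebra_simps)
    moreover have "b * (e3 \<bullet> n) * ((e3 \<bullet> y) * (e2 \<bullet> x)) = b * (e3 \<bullet> n) * ((e3 \<bullet> x) * (e2 \<bullet> y))"
      using arg_cong[OF x(4), of "\<lambda>v. (e3 \<bullet> y) * v"] arg_cong[OF y(4), of "\<lambda>v. (e3 \<bullet> x) * v"]
      by (simp add: algebra_simps)
    ultimately have "(e3 \<bullet> y) *\<^sub>R x = (e3 \<bullet> x) *\<^sub>R y"
      using ab n3 by (intro frame_eqI) auto
    then show "P = Q"
      unfolding x(1) y(1) using ell_point_scaleR x(2) y(2) by metis
  qed
next
  assume once: "meets_at_most_once (line_of_normal n) (frame_conic a b)"
  show "(e1 \<bullet> n)\<^sup>2 / a + (e2 \<bullet> n)\<^sup>2 / b \<le> (e3 \<bullet> n)\<^sup>2"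
  proof (rule ccontr)
    assume sec: "\<not> ?thesis"
    define N where "N = (e1 \<bullet> n)\<^sup>2 / a + (e2 \<bullet> n)\<^sup>2 / b"
    define h where "h = sqrt (N - (e3 \<bullet> n)\<^sup>2)"
    have N: "0 < N" using sec zero_le_power2[of "e3 \<bullet> n"] unfolding N_def by linarith
    have h: "h \<noteq> 0" and h2: "h\<^sup>2 = N - (e3 \<bullet> n)\<^sup>2" using sec by (auto simp: h_def N_def)
    \<comment> \<open>the two intersection points are \<open>x 1\<close> and \<open>x (- 1)\<close>\<close>
    define x where "x \<sigma> = (- (e3 \<bullet> n) * (e1 \<bullet> n) / a + (\<sigma> * h) * (e2 \<bullet> n) / sqrt (a * b)) *\<^sub>R e1
      + (- (e3 \<bullet> n) * (e2 \<bullet> n) / b - (\<sigma> * h) * (e1 \<bullet> n) / sqrt (a * b)) *\<^sub>R e2 + N *\<^sub>R e3" for \<sigma>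
    have c: "e1 \<bullet> x \<sigma> = - (e3 \<bullet> n) * (e1 \<bullet> n) / a + (\<sigma> * h) * (e2 \<bullet> n) / sqrt (a * b)"
      "e2 \<bullet> x \<sigma> = - (e3 \<bullet> n) * (e2 \<bullet> n) / b - (\<sigma> * h) * (e1 \<bullet> n) / sqrt (a * b)"
      "e3 \<bullet> x \<sigma> = N" for \<sigma>
      by (simp_all add: x_def inner_add_right)
    have nz: "x \<sigma> \<noteq> 0" for \<sigma> using c(3)[of \<sigma>] N by (metis inner_zero_right less_irrefl)
    have common: "ell_point (x \<sigma>) \<in> line_of_normal n \<inter> ell_point ` frame_conic a b"
      if \<sigma>: "\<sigma>\<^sup>2 = 1" for \<sigma>
    proof -
      have "(\<sigma> * h)\<^sup>2 = (e1 \<bullet> n)\<^sup>2 / a + (e2 \<bullet> n)\<^sup>2 / b - (e3 \<bullet> n)\<^sup>2"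
        using \<sigma> h2 by (simp add: power_mult_distrib N_def)
      note secant_point[OF ab this c(1,2) c(3)[unfolded N_def], of \<sigma>]
      then have cone: "a * (e1 \<bullet> x \<sigma>)\<^sup>2 + b * (e2 \<bullet> x \<sigma>)\<^sup>2 = (e3 \<bullet> x \<sigma>)\<^sup>2"
        and inc: "n \<bullet> x \<sigma> = 0" by (simp_all only: inner_frame[of n])
      define r where "r = 1 / norm (x \<sigma>)"
      have r: "r \<noteq> 0" "norm (r *\<^sub>R x \<sigma>) = 1" using nz by (auto simp: r_def)
      have "a * (e1 \<bullet> (r *\<^sub>R x \<sigma>))\<^sup>2 + b * (e2 \<bullet> (r *\<^sub>R x \<sigma>))\<^sup>2
          = r\<^sup>2 * (a * (e1 \<bullet> x \<sigma>)\<^sup>2 + b * (e2 \<bullet> x \<sigma>)\<^sup>2)"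
        by (simp add: power_mult_distrib algebra_simps)
      then have "r *\<^sub>R x \<sigma> \<in> frame_conic a b"
        using r by (simp add: cone frame_conic_def power_mult_distrib del: norm_scaleR)
      moreover have "ell_point (r *\<^sub>R x \<sigma>) \<in> line_of_normal n"
        using r inc by (subst ell_point_in_line_of_normal) auto
      ultimately show ?thesis using ell_point_scaleR[OF r(1), of "x \<sigma>"] by (metis IntI imageI)
    qed
    have "ell_point (x 1) = ell_point (x (-1))"
      using once common[of 1] common[of "-1"] unfolding meets_at_most_once_def by auto
    then obtain k where k: "x 1 = k *\<^sub>R x (-1)" using ell_point_eq_imp_scale nz by metis
    then have "e3 \<bullet> x 1 = k * (e3 \<bullet> x (-1))" by simp
    then have "k = 1" using N by (simp add: c)
    then have "x 1 = x (-1)" using k by simp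
    then have "e1 \<bullet> x 1 = e1 \<bullet> x (-1)" "e2 \<bullet> x 1 = e2 \<bullet> x (-1)" by simp_all
    then have "e2 \<bullet> n = 0" "e1 \<bullet> n = 0" using h ab by (simp_all add: c)
    then show False using N by (simp add: N_def)
  qed
qed

lemma solid_cone_frame:
  "{t *\<^sub>R x | t x. 0 \<le> t \<and> t \<le> 1 \<and>
      x \<in> {x \<in> sphere 0 1. s * (e1 \<bullet> x)\<^sup>2 + r * (e2 \<bullet> x)\<^sup>2 \<le> (e3 \<bullet> x)\<^sup>2}}
    = {x. norm x \<le> 1 \<and> s * (e1 \<bullet> x)\<^sup>2 + r * (e2 \<bullet> x)\<^sup>2 \<le> (e3 \<bullet> x)\<^sup>2}"
    (is "?L = ?R")
proof (intro equalityI subsetI)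
  fix y assume "y \<in> ?L"
  then obtain t x where y: "y = t *\<^sub>R x" and t: "0 \<le> t" "t \<le> 1" and x: "norm x = 1"
    and q: "s * (e1 \<bullet> x)\<^sup>2 + r * (e2 \<bullet> x)\<^sup>2 \<le> (e3 \<bullet> x)\<^sup>2" by auto
  have "t\<^sup>2 * (s * (e1 \<bullet> x)\<^sup>2 + r * (e2 \<bullet> x)\<^sup>2) \<le> t\<^sup>2 * (e3 \<bullet> x)\<^sup>2"
    using q by (intro mult_left_mono) auto
  then show "y \<in> ?R" using t x by (simp add: y power_mult_distrib algebra_simps)
next
  fix y assume y: "y \<in> ?R"
  show "y \<in> ?L"
  proof (cases "y = 0")
    case True
    \<comment> \<open>the apex is \<open>0\<close> times any point of the region, and \<open>e3\<close> is one\<close>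
    then have "y = 0 *\<^sub>R e3" "e3 \<in> {x \<in> sphere 0 1. s * (e1 \<bullet> x)\<^sup>2 + r * (e2 \<bullet> x)\<^sup>2 \<le> (e3 \<bullet> x)\<^sup>2}"
      by (simp_all add: norm_eq_1)
    then show ?thesis by (intro CollectI exI[of _ 0] exI[of _ e3]) simp
  next
    case False
    define i where "i = inverse (norm y)"
    have "i\<^sup>2 * (s * (e1 \<bullet> y)\<^sup>2 + r * (e2 \<bullet> y)\<^sup>2) \<le> i\<^sup>2 * (e3 \<bullet> y)\<^sup>2"
      using y by (intro mult_left_mono) auto
    then have "i *\<^sub>R y \<in> {x \<in> sphere 0 1. s * (e1 \<bullet> x)\<^sup>2 + r * (e2 \<bullet> x)\<^sup>2 \<le> (e3 \<bullet> x)\<^sup>2}"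
      using False by (simp add: power_mult_distrib algebra_simps i_def)
    moreover have "y = norm y *\<^sub>R (i *\<^sub>R y)" using False by (simp add: i_def)
    ultimately show ?thesis using y by (intro CollectI exI[of _ "norm y"] exI[of _ "i *\<^sub>R y"]) simp
  qed
qed

text \<open>
  The poles of the lines counted by the measure fill the dual region, which is bounded by the conic with
  the reciprocal parameters. The factor \<open>3\<close> is \<open>2 * 3 / 2\<close>: the wedge is twice the integral, area is
  three times the volume of the cone, and antipodal points are counted once.
\<close>

lemma conic_measure_frame_conic:
  assumes ab: "0 < a" "0 < b"
  shows "conic_measure (frame_conic a b) = 2 * pi - 3 * wedge_integral (1 / a, 1 / b)"
proof -
  let ?A = "{x \<in> sphere 0 1. 1 / a * (e1 \<bullet> x)\<^sup>2 + 1 / b * (e2 \<bullet> x)\<^sup>2 \<le> (e3 \<bullet> x)\<^sup>2}"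
  have "\<Union> (abs_pole ` {K \<in> elliptic_lines. meets_at_most_once K (frame_conic a b)}) = ?A"
  proof (intro equalityI subsetI)
    fix x assume "x \<in> \<Union> (abs_pole ` {K \<in> elliptic_lines. meets_at_most_once K (frame_conic a b)})"
    then obtain K where K: "K \<in> elliptic_lines" "meets_at_most_once K (frame_conic a b)" "x \<in> abs_pole K"
      by auto
    obtain n where n: "norm n = 1" "K = line_of_normal n" "abs_pole K = {n, - n}"
      using elliptic_line_obtain_normal[OF K(1)] .
    have "n \<noteq> 0" using n by auto
    then show "x \<in> ?A" using K n by (auto simp: meets_at_most_once_frame_conic[OF ab])
  next
    fix x assume x: "x \<in> ?A"
    then have "x \<noteq> 0" by auto
    moreover have "x \<in> ell_point x" using x by (simp add: ell_point_unit)
    ultimately have "x \<in> abs_pole (line_of_normal x)" "line_of_normal x \<in> elliptic_lines"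
      "meets_at_most_once (line_of_normal x) (frame_conic a b)"
      using x by (auto simp: abs_pole_line_of_normal line_of_normal_in_elliptic_lines
          meets_at_most_once_frame_conic[OF ab])
    then show "x \<in> \<Union> (abs_pole ` {K \<in> elliptic_lines. meets_at_most_once K (frame_conic a b)})" by blast
  qed
  then have "conic_measure (frame_conic a b) = 3 * (4 / 3 * pi - 2 * wedge_integral (1 / a, 1 / b)) / 2"
    using measure_cone[of "(1 / a, 1 / b)"] ab
    by (simp only: conic_measure_def line_measure_def elliptic_area_def sphere_area_def
        solid_cone_frame) simp
  then show ?thesis by simp
qed

section \<open>Conics with given axes\<close>

lemma conic_eq_frame_conic:
  assumes "M *v e1 = a *\<^sub>R e1" "M *v e2 = b *\<^sub>R e2" "M *v e3 = - e3"
  shows "conic M = frame_conic a b"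
proof -
  have "x \<bullet> (M *v x) = a * (e1 \<bullet> x)\<^sup>2 + b * (e2 \<bullet> x)\<^sup>2 - (e3 \<bullet> x)\<^sup>2" for x
  proof -
    have "M *v x = M *v ((e1 \<bullet> x) *\<^sub>R e1 + (e2 \<bullet> x) *\<^sub>R e2 + (e3 \<bullet> x) *\<^sub>R e3)"
      using frame_expand[of x] by simp
    also have "\<dots> = (e1 \<bullet> x) *\<^sub>R (a *\<^sub>R e1) + (e2 \<bullet> x) *\<^sub>R (b *\<^sub>R e2) + (e3 \<bullet> x) *\<^sub>R (- e3)"
      by (simp add: matrix_vector_right_distrib matrix_vector_mult_scaleR assms)
    finally show ?thesis
      by (simp add: inner_add_right inner_diff_right power2_eq_square inner_commute[of x])
  qed
  then show ?thesis by (simp add: conic_def frame_conic_def)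
qed

lemma coord_frame_conic_matrix:
  "coord *v (frame_conic_matrix a b *v x) = diag3 a b (- 1) *v (coord *v x)"
  unfolding frame_conic_matrix_def
  by (simp add: transpose_matrix_vector flip: matrix_vector_mul_assoc)

lemma diag3_mult_nth:
  "(diag3 a b c *v x) $ 1 = a * x $ 1" "(diag3 a b c *v x) $ 2 = b * x $ 2"
  "(diag3 a b c *v x) $ 3 = c * x $ 3"
  by (simp_all add: matrix_vector_mult_def diag3_def sum_3)

lemma frame_conic_matrix_inner:
  "e1 \<bullet> (frame_conic_matrix a b *v x) = a * (e1 \<bullet> x)"
  "e2 \<bullet> (frame_conic_matrix a b *v x) = b * (e2 \<bullet> x)"
  "e3 \<bullet> (frame_conic_matrix a b *v x) = - (e3 \<bullet> x)"
  using coord_frame_conic_matrix[of a b x] by (simp_all add: vec_eq_iff forall_3 diag3_mult_nth)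

lemma frame_conic_matrix_eigen:
  "frame_conic_matrix a b *v e1 = a *\<^sub>R e1"
  "frame_conic_matrix a b *v e2 = b *\<^sub>R e2"
  "frame_conic_matrix a b *v e3 = - e3"
  by (rule frame_eqI; simp add: frame_conic_matrix_inner)+

lemma transpose_frame_conic_matrix: "transpose (frame_conic_matrix a b) = frame_conic_matrix a b"
proof -
  have "transpose (diag3 a b (- 1)) = diag3 a b (- 1)"
    by (simp add: transpose_def diag3_def vec_eq_iff)
  then show ?thesis by (simp add: frame_conic_matrix_def matrix_transpose_mul matrix_mul_assoc)
qed

lemma det_frame_conic_matrix:
  "det (mat t - frame_conic_matrix a b) = (t - a) * (t - b) * (t + 1)"
proof -
  let ?D = "diag3 a b (- 1)"
  have mat: "mat t *v x = t *\<^sub>R x" for x :: "real^3"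
    by (simp add: vec_eq_iff forall_3 matrix_vector_mult_def mat_def sum_3)
  have "(mat t - frame_conic_matrix a b) *v x = (transpose coord ** (mat t - ?D) ** coord) *v x" for x
  proof -
    have "coord *v ((mat t - frame_conic_matrix a b) *v x)
        = t *\<^sub>R (coord *v x) - ?D *v (coord *v x)"
      by (simp add: matrix_vector_mult_diff_rdistrib mat matrix_vector_mult_diff_distrib
          matrix_vector_mult_scaleR coord_frame_conic_matrix)
    also have "\<dots> = coord *v ((transpose coord ** (mat t - ?D) ** coord) *v x)"
      by (simp add: transpose_matrix_vector matrix_vector_mult_diff_rdistrib mat
          flip: matrix_vector_mul_assoc)
    finally show ?thesis by (metis coord_inverse(1))
  qed
  then have eq: "mat t - frame_conic_matrix a b = transpose coord ** (mat t - ?D) ** coord"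
    by (simp add: matrix_eq)
  have "det (transpose coord) * det coord = 1"
    by (simp only: det_mul[symmetric] transpose_coord det_I)
  then have "det (mat t - frame_conic_matrix a b) = det (mat t - ?D)"
    unfolding eq det_mul by algebra
  also have "\<dots> = (t - a) * (t - b) * (t + 1)"
    by (simp add: det_3 mat_def diag3_def)
  finally show ?thesis .
qed

lemma span_frame_pair:
  "span {e3, e1} = {x. e2 \<bullet> x = 0}" "span {e3, e2} = {x. e1 \<bullet> x = 0}"
proof -
  have 1: "span {e3, v} \<subseteq> {x. w \<bullet> x = 0}" if "w \<bullet> e3 = 0" "w \<bullet> v = 0" for v w
    using that by (intro span_minimal) (auto simp: subspace_hyperplane)
  have 2: "r *\<^sub>R v + q *\<^sub>R e3 \<in> span {e3, v}" for r q v
    by (intro span_add span_scale span_base) auto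
  have "x \<in> span {e3, e1}" if "e2 \<bullet> x = 0" for x
    using frame_expand[of x] 2[of "e1 \<bullet> x" e1 "e3 \<bullet> x"] that by simp
  moreover have "x \<in> span {e3, e2}" if "e1 \<bullet> x = 0" for x
    using frame_expand[of x] 2[of "e2 \<bullet> x" e2 "e3 \<bullet> x"] that by simp
  ultimately show "span {e3, e1} = {x. e2 \<bullet> x = 0}" "span {e3, e2} = {x. e1 \<bullet> x = 0}"
    using 1[of e2 e1] 1[of e1 e2] by auto
qed

lemma conic_matrix_frame_conic_matrix:
  assumes ab: "0 < a" "0 < b"
  shows "conic_matrix (frame_conic_matrix a b)"
    and "b \<le> a \<Longrightarrow> conic_eigenvalues (frame_conic_matrix a b) a b"
    and "a \<le> b \<Longrightarrow> conic_eigenvalues (frame_conic_matrix a b) b a"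
proof -
  let ?M = "frame_conic_matrix a b"
  show ev: "b \<le> a \<Longrightarrow> conic_eigenvalues ?M a b" "a \<le> b \<Longrightarrow> conic_eigenvalues ?M b a"
    using ab by (auto simp: conic_eigenvalues_def det_frame_conic_matrix)
  have "det (mat 0 - ?M) \<noteq> 0" using ab det_frame_conic_matrix[of 0 a b] by simp
  then have "invertible ((- 1) *\<^sub>R ?M)" by (simp add: invertible_det_nz mat_0)
  then have "invertible ?M" using scalar_invertible[of "-1" "(- 1) *\<^sub>R ?M"] by simp
  moreover have "e1 \<bullet> (?M *v e1) > 0" "e3 \<bullet> (?M *v e3) < 0"
    using ab by (simp_all add: frame_conic_matrix_inner)
  moreover have "\<exists>\<nu>\<^sub>1 \<nu>\<^sub>2. conic_eigenvalues ?M \<nu>\<^sub>1 \<nu>\<^sub>2" using ev by (meson linear)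
  ultimately show "conic_matrix ?M"
    unfolding conic_matrix_def using transpose_frame_conic_matrix by blast
qed

lemma has_axes_frame_conic:
  assumes ab: "0 < a" "0 < b"
  shows "has_axes (frame_conic a b) (line_of_normal e2) (line_of_normal e1)"
proof -
  let ?M = "frame_conic_matrix a b"
  note M = conic_matrix_frame_conic_matrix[OF ab] frame_conic_matrix_eigen[of a b]
  have C: "frame_conic a b = conic ?M" using M(4-6) by (intro conic_eq_frame_conic[symmetric])
  have L: "line_of_normal e2 = line_of_plane (span {e3, e1})"
    "line_of_normal e1 = line_of_plane (span {e3, e2})"
    by (simp_all add: line_of_normal_def span_frame_pair)
  show ?thesis
  proof (cases "b \<le> a")
    case True
    show ?thesis unfolding has_axes_def
      by (rule exI[of _ ?M], rule exI[of _ a], rule exI[of _ b], rule exI[of _ e3],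
          rule exI[of _ e1], rule exI[of _ e2])
        (use M(1) M(2,3) M(4-6) True C L in \<open>simp add: orthogonal_def\<close>)
  next
    case False
    show ?thesis unfolding has_axes_def
      by (rule exI[of _ ?M], rule exI[of _ b], rule exI[of _ a], rule exI[of _ e3],
          rule exI[of _ e2], rule exI[of _ e1])
        (use M(1) M(2,3) M(4-6) False C L in \<open>simp add: orthogonal_def insert_commute\<close>)
  qed
qed

text \<open>
  The eigenvectors lie in the planes of the axes and are orthogonal to \<open>c\<close>, which leaves only multiples
  of the frame vectors.
\<close>

lemma frame_conic_if_eigenvectors:
  assumes M: "transpose M = M" and c: "M *v c = - c" "c \<noteq> 0"
    and u: "M *v u = a *\<^sub>R u" "u \<noteq> 0" and v: "M *v v = b *\<^sub>R v" "v \<noteq> 0" and ab: "0 < a" "0 < b"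
    and su: "{x. e2 \<bullet> x = 0} = span {c, u}" and sv: "{x. e1 \<bullet> x = 0} = span {c, v}"
  shows "conic M = frame_conic a b"
proof (rule conic_eq_frame_conic)
  have cu: "c \<bullet> u = 0" "c \<bullet> v = 0"
    using symmetric_eigenvectors_orthogonal[of M c "-1"] M c u v ab by auto
  have "c \<in> {x. e2 \<bullet> x = 0}" "u \<in> {x. e2 \<bullet> x = 0}" "c \<in> {x. e1 \<bullet> x = 0}" "v \<in> {x. e1 \<bullet> x = 0}"
    unfolding su sv by (auto intro: span_base)
  then have e: "e2 \<bullet> c = 0" "e2 \<bullet> u = 0" "e1 \<bullet> c = 0" "e1 \<bullet> v = 0" by auto
  have c3: "c = (e3 \<bullet> c) *\<^sub>R e3" by (rule frame_eqI) (simp_all add: e)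
  then have c3': "e3 \<bullet> c \<noteq> 0" using c by auto
  have "e3 \<bullet> u = 0" "e3 \<bullet> v = 0"
    using cu c3' e by (simp_all add: inner_frame[of c])
  then have u1: "u = (e1 \<bullet> u) *\<^sub>R e1" and v2: "v = (e2 \<bullet> v) *\<^sub>R e2"
    by (auto intro!: frame_eqI simp: e)
  have eigen: "M *v w = \<mu> *\<^sub>R w" if "z = r *\<^sub>R w" "z \<noteq> 0" "M *v z = \<mu> *\<^sub>R z" for z w r \<mu>
  proof -
    have "r *\<^sub>R (M *v w) = r *\<^sub>R (\<mu> *\<^sub>R w)"
      using that by (simp add: matrix_vector_mult_scaleR)
    moreover have "r \<noteq> 0" using that by auto
    ultimately show ?thesis using scaleR_left_imp_eq by blast
  qed
  show "M *v e1 = a *\<^sub>R e1" using eigen[OF u1 u(2,1)] .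
  show "M *v e2 = b *\<^sub>R e2" using eigen[OF v2 v(2,1)] .
  show "M *v e3 = - e3" using eigen[OF c3 c(2), of "-1"] c(1) by simp
qed

lemma has_axes_iff:
  "has_axes C (line_of_normal e2) (line_of_normal e1) \<longleftrightarrow> (\<exists>a>0. \<exists>b>0. C = frame_conic a b)"
proof
  assume "has_axes C (line_of_normal e2) (line_of_normal e1)"
  then obtain M \<nu>\<^sub>1 \<nu>\<^sub>2 c u\<^sub>1 u\<^sub>2 where M: "conic_matrix M" "C = conic M" "conic_eigenvalues M \<nu>\<^sub>1 \<nu>\<^sub>2"
    and c: "c \<noteq> 0" "M *v c = - c" and u: "u\<^sub>1 \<noteq> 0" "M *v u\<^sub>1 = \<nu>\<^sub>1 *\<^sub>R u\<^sub>1"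
    and v: "u\<^sub>2 \<noteq> 0" "M *v u\<^sub>2 = \<nu>\<^sub>2 *\<^sub>R u\<^sub>2"
    and axes: "{line_of_normal e2, line_of_normal e1} =
      {line_of_plane (span {c, u\<^sub>1}), line_of_plane (span {c, u\<^sub>2})}"
    unfolding has_axes_def by (elim exE conjE) (rule that)
  have pos: "0 < \<nu>\<^sub>1" "0 < \<nu>\<^sub>2" using M(3) by (auto simp: conic_eigenvalues_def)
  have sym: "transpose M = M" using M(1) by (simp add: conic_matrix_def)
  have plane: "line_of_normal w = line_of_plane (span S) \<longleftrightarrow> {x. w \<bullet> x = 0} = span S" for w S
    unfolding line_of_normal_def by (intro line_of_plane_inject subspace_hyperplane subspace_span)
  consider "{x. e2 \<bullet> x = 0} = span {c, u\<^sub>1}" "{x. e1 \<bullet> x = 0} = span {c, u\<^sub>2}"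
    | "{x. e2 \<bullet> x = 0} = span {c, u\<^sub>2}" "{x. e1 \<bullet> x = 0} = span {c, u\<^sub>1}"
    using axes unfolding doubleton_eq_iff plane by blast
  then show "\<exists>a>0. \<exists>b>0. C = frame_conic a b"
  proof cases
    case 1
    then have "C = frame_conic \<nu>\<^sub>1 \<nu>\<^sub>2"
      using frame_conic_if_eigenvectors[OF sym c(2,1) u(2,1) v(2,1)] pos M(2) by simp
    then show ?thesis using pos by blast
  next
    case 2
    then have "C = frame_conic \<nu>\<^sub>2 \<nu>\<^sub>1"
      using frame_conic_if_eigenvectors[OF sym c(2,1) v(2,1) u(2,1)] pos M(2) by simp
    then show ?thesis using pos by blast
  qed
qed (use has_axes_frame_conic in auto)

section \<open>Feasible parameters and the minimal conic\<close>

text \<open>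
  The choice of a representative is harmless because antipodal vectors have the same squared height; by
  the universal property of the quotient the squared height is continuous on the elliptic plane.
\<close>

lemma continuous_map_polar_height:
  "continuous_map elliptic_topology euclideanreal (\<lambda>p. (e3 \<bullet> (SOME x. x \<in> p))\<^sup>2)"
proof (rule continuous_compose_quotient_map[OF quotient_map_ell_point])
  have "continuous_map (top_of_set (sphere 0 1)) euclideanreal (\<lambda>x. (e3 \<bullet> x)\<^sup>2)"
    by (auto intro!: continuous_intros)
  moreover have "(e3 \<bullet> (SOME y. y \<in> ell_point x))\<^sup>2 = (e3 \<bullet> x)\<^sup>2"
    if "x \<in> sphere 0 1" for x
  proof -
    have "(SOME y. y \<in> {x, - x}) \<in> {x, - x}" by (rule someI[of _ x]) simp
    then show ?thesis using that by (auto simp: ell_point_unit)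
  qed
  ultimately show "continuous_map (top_of_set (sphere 0 1)) euclideanreal
      ((\<lambda>p. (e3 \<bullet> (SOME x. x \<in> p))\<^sup>2) \<circ> ell_point)"
    by (elim continuous_map_eq) auto
qed

definition feasible :: "(real^3) set \<Rightarrow> (real \<times> real) set" where
  "feasible N = {k. 0 \<le> fst k \<and> 0 \<le> snd k \<and>
     (\<forall>n\<in>N. fst k * (e1 \<bullet> n)\<^sup>2 + snd k * (e2 \<bullet> n)\<^sup>2 \<le> (e3 \<bullet> n)\<^sup>2)}"

lemma feasible_eq_Inter_halfspaces:
  "feasible N = {k. (-1, 0) \<bullet> k \<le> 0} \<inter> {k. (0, -1) \<bullet> k \<le> 0} \<inter>
    (\<Inter>n\<in>N. {k. ((e1 \<bullet> n)\<^sup>2, (e2 \<bullet> n)\<^sup>2) \<bullet> k \<le> (e3 \<bullet> n)\<^sup>2})"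
  by (auto simp: feasible_def inner_prod_def mult.commute)

lemma convex_feasible: "convex (feasible N)"
  unfolding feasible_eq_Inter_halfspaces by (intro convex_Int convex_INT convex_halfspace_le)

text \<open>
  A pole that is not orthogonal to \<open>e1\<close> bounds the first parameter, and a pole that is not orthogonal to
  \<open>e2\<close> bounds the second.
\<close>

lemma compact_feasible:
  assumes m: "m \<in> N" "e1 \<bullet> m \<noteq> 0" and n: "n \<in> N" "e2 \<bullet> n \<noteq> 0"
  shows "compact (feasible N)"
  unfolding compact_eq_bounded_closed
proof
  show "closed (feasible N)"
    unfolding feasible_eq_Inter_halfspaces by (intro closed_Int closed_INT ballI closed_halfspace_le)
  have "fst k \<le> (e3 \<bullet> m)\<^sup>2 / (e1 \<bullet> m)\<^sup>2" "snd k \<le> (e3 \<bullet> n)\<^sup>2 / (e2 \<bullet> n)\<^sup>2" if k: "k \<in> feasible N" for k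
  proof -
    have nn: "0 \<le> fst k" "0 \<le> snd k" using k by (auto simp: feasible_def)
    have "fst k * (e1 \<bullet> m)\<^sup>2 + snd k * (e2 \<bullet> m)\<^sup>2 \<le> (e3 \<bullet> m)\<^sup>2"
      "fst k * (e1 \<bullet> n)\<^sup>2 + snd k * (e2 \<bullet> n)\<^sup>2 \<le> (e3 \<bullet> n)\<^sup>2"
      using k m n by (auto simp: feasible_def)
    moreover have "0 \<le> snd k * (e2 \<bullet> m)\<^sup>2" "0 \<le> fst k * (e1 \<bullet> n)\<^sup>2" using nn by auto
    ultimately have "fst k * (e1 \<bullet> m)\<^sup>2 \<le> (e3 \<bullet> m)\<^sup>2" "snd k * (e2 \<bullet> n)\<^sup>2 \<le> (e3 \<bullet> n)\<^sup>2" by linarith+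
    then show "fst k \<le> (e3 \<bullet> m)\<^sup>2 / (e1 \<bullet> m)\<^sup>2" "snd k \<le> (e3 \<bullet> n)\<^sup>2 / (e2 \<bullet> n)\<^sup>2"
      using m n by (simp_all add: pos_le_divide_eq)
  qed
  then have "feasible N \<subseteq> cbox (0, 0) ((e3 \<bullet> m)\<^sup>2 / (e1 \<bullet> m)\<^sup>2, (e3 \<bullet> n)\<^sup>2 / (e2 \<bullet> n)\<^sup>2)"
    by (auto simp: feasible_def cbox_Pair_eq)
  then show "bounded (feasible N)" using bounded_cbox bounded_subset by blast
qed

lemma contains_lines_frame_conic:
  assumes "\<L> \<subseteq> elliptic_lines" "0 < a" "0 < b"
  shows "contains_lines (frame_conic a b) \<L> \<longleftrightarrow>
    (1 / a, 1 / b) \<in> feasible (\<Union> (abs_pole ` \<L>))"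
proof -
  have "meets_at_most_once K (frame_conic a b) \<longleftrightarrow>
      (\<forall>n\<in>abs_pole K. (e1 \<bullet> n)\<^sup>2 / a + (e2 \<bullet> n)\<^sup>2 / b \<le> (e3 \<bullet> n)\<^sup>2)" if K: "K \<in> \<L>" for K
  proof -
    obtain n where n: "norm n = 1" "K = line_of_normal n" "abs_pole K = {n, - n}"
      using elliptic_line_obtain_normal K assms(1) by blast
    then have "n \<noteq> 0" by auto
    then show ?thesis using n assms by (simp add: meets_at_most_once_frame_conic)
  qed
  then show ?thesis using assms by (auto simp: contains_lines_def feasible_def)
qed

text \<open>
  The admissible conics correspond to the feasible parameters with positive entries, and the measure is
  a decreasing affine function of the wedge volume. So \<open>wedge_integral_unique_maximum\<close> applies once
  the feasible set is known to be compact and to contain a positive pair.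
\<close>

lemma unique_minimal_frame_conic:
  assumes lines: "\<L> \<subseteq> elliptic_lines"
    and compact: "compactin elliptic_topology (abs_pole ` \<L>)"
    and full: "full_dimensional (abs_pole ` \<L>)"
    and center: "\<forall>K\<in>\<L>. line_of_normal e2 \<inter> line_of_normal e1 \<inter> K = {}"
  shows "\<exists>!C. has_axes C (line_of_normal e2) (line_of_normal e1) \<and> contains_lines C \<L> \<and>
    (\<forall>D. has_axes D (line_of_normal e2) (line_of_normal e1) \<and> contains_lines D \<L> \<longrightarrow>
       conic_measure C \<le> conic_measure D)"
proof -
  define N where "N = \<Union> (abs_pole ` \<L>)"
  have pole: "\<exists>n. norm n = 1 \<and> K = line_of_normal n \<and> abs_pole K = {n, - n}" if "K \<in> \<L>" for K
    using that lines elliptic_line_obtain_normal by (metis subsetD)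
  have off: "\<exists>n\<in>N. w \<bullet> n \<noteq> 0" if w: "w \<noteq> 0" for w
  proof (rule ccontr)
    assume "\<not> ?thesis"
    then have w0: "w \<bullet> n = 0" if "n \<in> N" for n using that by blast
    have "abs_pole K \<in> line_of_normal w" if K: "K \<in> \<L>" for K
    proof -
      obtain n where n: "norm n = 1" "abs_pole K = {n, - n}" using pole[OF K] by blast
      then have "w \<bullet> n = 0" using K by (intro w0) (auto simp: N_def)
      then show ?thesis using n ell_point_in_line_of_normal[of n w] by (simp add: ell_point_unit)
    qed
    then show False using full line_of_normal_in_elliptic_lines[OF w]
      unfolding full_dimensional_def by blast
  qed
  obtain m n where mn: "m \<in> N" "e1 \<bullet> m \<noteq> 0" "n \<in> N" "e2 \<bullet> n \<noteq> 0"
    using off[of e1] off[of e2] by auto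
  \<comment> \<open>no line of \<open>\<L>\<close> passes through the center, so the squared height of its pole is positive, and
    by compactness it is bounded away from \<open>0\<close>\<close>
  obtain \<delta> where \<delta>: "0 < \<delta>" and \<delta>_le: "\<And>n. n \<in> N \<Longrightarrow> \<delta> \<le> (e3 \<bullet> n)\<^sup>2"
  proof -
    let ?h = "\<lambda>p. (e3 \<bullet> (SOME x. x \<in> p))\<^sup>2"
    have h: "?h (abs_pole K) = (e3 \<bullet> n)\<^sup>2" "0 < (e3 \<bullet> n)\<^sup>2" if K: "K \<in> \<L>" and n: "n \<in> abs_pole K" for K n
    proof -
      obtain l where l: "norm l = 1" "K = line_of_normal l" "abs_pole K = {l, - l}"
        using pole[OF K] by blast
      have "(SOME x. x \<in> abs_pole K) \<in> abs_pole K" using n by (rule someI)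
      then show "?h (abs_pole K) = (e3 \<bullet> n)\<^sup>2" using n l by auto
      have e3: "norm e3 = 1" by (simp add: norm_eq_1)
      then have "ell_point e3 \<in> line_of_normal e2 \<inter> line_of_normal e1"
        by (simp add: ell_point_in_line_of_normal)
      then have "ell_point e3 \<notin> K" using center K by blast
      then show "0 < (e3 \<bullet> n)\<^sup>2"
        using n l e3 by (auto simp: ell_point_in_line_of_normal inner_commute)
    qed
    have "compact (?h ` abs_pole ` \<L>)"
      using image_compactin[OF compact continuous_map_polar_height] by simp
    moreover have "?h ` abs_pole ` \<L> \<noteq> {}" using mn by (auto simp: N_def)
    ultimately obtain K where K: "K \<in> \<L>" and min: "\<And>J. J \<in> \<L> \<Longrightarrow> ?h (abs_pole K) \<le> ?h (abs_pole J)"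
      using compact_attains_inf[of "?h ` abs_pole ` \<L>"] by (auto simp del: some_in_eq)
    obtain l where "l \<in> abs_pole K" using pole[OF K] by blast
    then have "0 < ?h (abs_pole K)" using h[OF K] by metis
    moreover have "?h (abs_pole K) \<le> (e3 \<bullet> n)\<^sup>2" if "n \<in> N" for n
      using that min h(1) by (auto simp: N_def simp del: some_in_eq) (metis (no_types, lifting))
    ultimately show ?thesis using that by blast
  qed
  have unitN: "norm n = 1" if "n \<in> N" for n
    using that pole by (fastforce simp: N_def)
  have "(\<delta>, \<delta>) \<in> feasible N"
  proof -
    have "\<delta> * (e1 \<bullet> n)\<^sup>2 + \<delta> * (e2 \<bullet> n)\<^sup>2 \<le> (e3 \<bullet> n)\<^sup>2" if n: "n \<in> N" for n
    proof -
      have "(e1 \<bullet> n)\<^sup>2 + (e2 \<bullet> n)\<^sup>2 + (e3 \<bullet> n)\<^sup>2 = 1"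
        using unitN[OF n] inner_frame[of n n] by (simp add: norm_eq_1 power2_eq_square)
      then have "(e1 \<bullet> n)\<^sup>2 + (e2 \<bullet> n)\<^sup>2 \<le> 1" using zero_le_power2[of "e3 \<bullet> n"] by linarith
      then have "\<delta> * ((e1 \<bullet> n)\<^sup>2 + (e2 \<bullet> n)\<^sup>2) \<le> \<delta>" using \<delta> by (simp add: mult_left_le)
      then show ?thesis using \<delta>_le[OF n] by (simp add: distrib_left)
    qed
    then show ?thesis using \<delta> by (simp add: feasible_def)
  qed
  then have "\<exists>!k. k \<in> feasible N \<and> 0 < fst k \<and> 0 < snd k \<and>
    (\<forall>l\<in>feasible N. 0 < fst l \<and> 0 < snd l \<longrightarrow> wedge_integral l \<le> wedge_integral k)"
    using \<delta> mn by (intro wedge_integral_unique_maximum[of _ "(\<delta>, \<delta>)"] compact_feasible convex_feasible)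
      (auto simp: feasible_def)
  then obtain k where k: "k \<in> feasible N" "0 < fst k" "0 < snd k"
      "\<And>l. l \<in> feasible N \<Longrightarrow> 0 < fst l \<Longrightarrow> 0 < snd l \<Longrightarrow> wedge_integral l \<le> wedge_integral k"
    and uniq: "\<And>k'. k' \<in> feasible N \<Longrightarrow> 0 < fst k' \<Longrightarrow> 0 < snd k' \<Longrightarrow>
      (\<forall>l\<in>feasible N. 0 < fst l \<and> 0 < snd l \<longrightarrow> wedge_integral l \<le> wedge_integral k') \<Longrightarrow> k' = k"
    by (elim ex1E) blast
  define conic_of where "conic_of l = frame_conic (1 / fst l) (1 / snd l)" for l :: "real \<times> real"
  have admissible: "has_axes D (line_of_normal e2) (line_of_normal e1) \<and> contains_lines D \<L> \<longleftrightarrow>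
      (\<exists>l\<in>feasible N. 0 < fst l \<and> 0 < snd l \<and> D = conic_of l)" for D
  proof
    assume D: "has_axes D (line_of_normal e2) (line_of_normal e1) \<and> contains_lines D \<L>"
    then obtain a b where ab: "0 < a" "0 < b" "D = frame_conic a b" using has_axes_iff by blast
    then have "(1 / a, 1 / b) \<in> feasible N"
      using D contains_lines_frame_conic[OF lines, of a b] by (simp add: N_def)
    moreover have "D = conic_of (1 / a, 1 / b)" using ab by (simp add: conic_of_def)
    ultimately show "\<exists>l\<in>feasible N. 0 < fst l \<and> 0 < snd l \<and> D = conic_of l"
      using ab by (intro bexI[of _ "(1 / a, 1 / b)"]) auto
  next
    assume "\<exists>l\<in>feasible N. 0 < fst l \<and> 0 < snd l \<and> D = conic_of l"
    then obtain l where l: "l \<in> feasible N" "0 < fst l" "0 < snd l" "D = conic_of l" by blast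
    then show "has_axes D (line_of_normal e2) (line_of_normal e1) \<and> contains_lines D \<L>"
      using contains_lines_frame_conic[OF lines, of "1 / fst l" "1 / snd l"]
        has_axes_frame_conic[of "1 / fst l" "1 / snd l"] by (simp add: conic_of_def N_def)
  qed
  have measure: "conic_measure (conic_of l) = 2 * pi - 3 * wedge_integral l"
    if "0 < fst l" "0 < snd l" for l
    using that conic_measure_frame_conic[of "1 / fst l" "1 / snd l"] by (simp add: conic_of_def)
  show ?thesis
  proof (rule ex1I[of _ "conic_of k"])
    show "has_axes (conic_of k) (line_of_normal e2) (line_of_normal e1) \<and>
      contains_lines (conic_of k) \<L> \<and>
      (\<forall>D. has_axes D (line_of_normal e2) (line_of_normal e1) \<and> contains_lines D \<L> \<longrightarrow>
       conic_measure (conic_of k) \<le> conic_measure D)"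
    unfolding conj_assoc[symmetric]
    proof (rule conjI)
      show "has_axes (conic_of k) (line_of_normal e2) (line_of_normal e1) \<and>
          contains_lines (conic_of k) \<L>"
        using admissible k by blast
      show "\<forall>D. has_axes D (line_of_normal e2) (line_of_normal e1) \<and> contains_lines D \<L> \<longrightarrow>
          conic_measure (conic_of k) \<le> conic_measure D"
      proof (intro allI impI)
        fix D assume "has_axes D (line_of_normal e2) (line_of_normal e1) \<and> contains_lines D \<L>"
        then obtain l where "l \<in> feasible N" "0 < fst l" "0 < snd l" "D = conic_of l"
          using admissible by blast
        then show "conic_measure (conic_of k) \<le> conic_measure D" using k by (simp add: measure)
      qed
    qed
  next
    fix C assume C: "has_axes C (line_of_normal e2) (line_of_normal e1) \<and> contains_lines C \<L> \<and>
      (\<forall>D. has_axes D (line_of_normal e2) (line_of_normal e1) \<and> contains_lines D \<L> \<longrightarrow>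
       conic_measure C \<le> conic_measure D)"
    then obtain l where l: "l \<in> feasible N" "0 < fst l" "0 < snd l" "C = conic_of l"
      using admissible by blast
    have "wedge_integral j \<le> wedge_integral l" if j: "j \<in> feasible N" "0 < fst j" "0 < snd j" for j
    proof -
      have "conic_measure C \<le> conic_measure (conic_of j)" using C j admissible[of "conic_of j"] by blast
      then show ?thesis using l j by (simp add: measure)
    qed
    then have "l = k" using l by (intro uniq) auto
    then show "C = conic_of k" using l by simp
  qed
qed

end

theorem corollary10:
  fixes \<L> :: "(real^3) set set set" and X Y :: "(real^3) set set"
  assumes lines: "\<L> \<subseteq> elliptic_lines"
    and bounded: "elliptic_bounded (abs_pole ` \<L>)"
    and compact: "compactin elliptic_topology (abs_pole ` \<L>)"
    and full: "full_dimensional (abs_pole ` \<L>)"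
    and axes: "orthogonal_lines X Y"
    and center: "\<forall>K\<in>\<L>. X \<inter> Y \<inter> K = {}"
  shows "\<exists>!C. has_axes C X Y \<and> contains_lines C \<L> \<and>
    (\<forall>D. has_axes D X Y \<and> contains_lines D \<L> \<longrightarrow> conic_measure C \<le> conic_measure D)"
proof -
  obtain e2 where e2: "norm e2 = 1" "X = line_of_normal e2" "abs_pole X = {e2, - e2}"
    using axes elliptic_line_obtain_normal unfolding orthogonal_lines_def by metis
  obtain e1 where e1: "norm e1 = 1" "Y = line_of_normal e1" "abs_pole Y = {e1, - e1}"
    using axes elliptic_line_obtain_normal unfolding orthogonal_lines_def by metis
  have o: "e1 \<bullet> e2 = 0"
    using axes e1 e2 by (auto simp: orthogonal_lines_def orthogonal_def inner_commute)
  define e3 where "e3 = cross3 e1 e2"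
  have "e3 \<bullet> e3 = 1"
    using norm_cross_dot[of e1 e2] e1(1) e2(1) o by (simp add: e3_def dot_square_norm)
  then interpret orthonormal_frame e1 e2 e3
    using e1 e2 o by unfold_locales (simp_all add: norm_eq_1 e3_def dot_cross_self)
  show ?thesis
    using unique_minimal_frame_conic[OF lines compact full] center unfolding e1(2) e2(2) .
qed

end
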